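(* Let $A_n$ be the nonsymmetric multilevel Toeplitz matrix $$A_n=\nu I_n+\sum_{i=1}^d\left(v_{i,+}W_i+v_{i,-}W_i^{\top}\right),\qquad W_i=I_{n_i^-}\otimes L_{n_i}^{(\alpha_i)}\otimes I_{n_i^+},$$ and let $P_n$ be the multilevel Tau preconditioner $$P_n=\nu I_n+\sum_{i=1}^d(v_{i,+}+v_{i,-})\,I_{n_i^-}\otimes\tau\!\left(\mathcal{H}\!\left(L_{n_i}^{(\alpha_i)}\right)\right)\otimes I_{n_i^+}.$$ Then the eigenvalues of $P_n^{-1}Y_nA_n$ lie in $$\left(-\tfrac32(1+\epsilon),-\tfrac12\right)\cup\left(\tfrac12,\tfrac32(1+\epsilon)\right)$$ for some $\epsilon$ with $$\epsilon<\max_{1\le i\le d}\frac{|d_{i,+}-d_{i,-}|}{d_{i,+}+d_{i,-}}\left|\tan\left(\frac{\alpha_i}{2}\pi\right)\right|.$$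
   Context: Setting (second-order scheme): $d\ge1$; for $i=1,\dots,d$: real numbers $a_i<b_i$, $\alpha_i\in(1,2)$, nonnegative constants $d_{i,+},d_{i,-}$, positive integers $n_i$, $h_i=(b_i-a_i)/(n_i+1)$, $v_{i,\pm}=d_{i,\pm}/(2h_i^{\alpha_i})$. Further $\nu=1/\tau$ with time step $\tau=T/M$, $T>0$, $M$ a positive integer. $n=\prod_{i=1}^dn_i$, $n_i^-=\prod_{j=1}^{i-1}n_j$, $n_i^+=\prod_{j=i+1}^dn_j$ (empty products equal $1$). $I_m$ is the $m\times m$ identity, $\otimes$ the Kronecker product. For $\alpha\in(1,2)$: $g_0^{(\alpha)}=1$, $g_k^{(\alpha)}=\left(1-\frac{\alpha+1}{k}\right)g_{k-1}^{(\alpha)}$ for $k\ge1$; $w_0^{(\alpha)}=\frac{\alpha}{2}g_0^{(\alpha)}$, $w_k^{(\alpha)}=\frac{\alpha}{2}g_k^{(\alpha)}+\frac{2-\alpha}{2}g_{k-1}^{(\alpha)}$ for $k\ge1$; $L_m^{(\alpha)}\in\mathbb{R}^{m\times m}$ is the Toeplitz matrix with $(j,k)$ entry $-w_{j-k+1}^{(\alpha)}$ if $j-k\ge-1$ and $0$ otherwise. $\mathcal{H}(Z)=(Z+Z^{\top})/2$ for a real square matrix $Z$. For a symmetric Toeplitz matrix $T_m$ with first column $(t_1,\dots,t_m)^{\top}$, $\tau(T_m):=T_m-H_m$, where $H_m$ is the Hankel matrix with first column $(t_3,t_4,\dots,t_m,0,0)^{\top}$ and last column $(0,0,t_m,\dots,t_4,t_3)^{\top}$.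 $Y_m$ is the $m\times m$ anti-identity matrix ($[Y_m]_{j,k}=1$ iff $j+k=m+1$, else $0$) and $Y_n=Y_{n_1}\otimes\cdots\otimes Y_{n_d}$ (which is again the $n\times n$ anti-identity). *)

theory Defs
  imports
    Complex_Main
    "Jordan_Normal_Form.Spectral_Radius"
begin

text \<open>
  Matrices are those of the Jordan Normal Form library: rows and columns are numbered from 0.
  The levels \<open>i = 1, \<dots>, d\<close> are numbered from 1, and level-dependent data are functions of \<open>i\<close>
  of which only the values on \<open>{1..d}\<close> matter.
\<close>

fun g_coeff :: "real \<Rightarrow> nat \<Rightarrow> real" where
  "g_coeff \<alpha> 0 = 1"
| "g_coeff \<alpha> (Suc k) = (1 - (\<alpha> + 1) / real (Suc k)) * g_coeff \<alpha> k"

fun w_coeff :: "real \<Rightarrow> nat \<Rightarrow> real" where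
  "w_coeff \<alpha> 0 = \<alpha> / 2 * g_coeff \<alpha> 0"
| "w_coeff \<alpha> (Suc k) = \<alpha> / 2 * g_coeff \<alpha> (Suc k) + (2 - \<alpha>) / 2 * g_coeff \<alpha> k"

definition L_mat :: "real \<Rightarrow> nat \<Rightarrow> real mat" where
  "L_mat \<alpha> m = mat m m (\<lambda>(j, k). if k \<le> j + 1 then - w_coeff \<alpha> (j + 1 - k) else 0)"

definition sym_part :: "real mat \<Rightarrow> real mat" where
  "sym_part Z = (1 / 2) \<cdot>\<^sub>m (Z + transpose_mat Z)"

text \<open>
  The \<open>m \<times> m\<close> Hankel matrix with first column \<open>c\<close> and last column \<open>r\<close>;
  the common corner entry is taken from \<open>c\<close>.
\<close>

definition hankel_mat :: "nat \<Rightarrow> real vec \<Rightarrow> real vec \<Rightarrow> real mat" where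
  "hankel_mat m c r = mat m m (\<lambda>(j, k). if j + k < m then c $ (j + k) else r $ (j + k - (m - 1)))"

text \<open>
  \<open>T\<close> is meant to be symmetric Toeplitz with first column \<open>(t\<^sub>1, \<dots>, t\<^sub>m)\<close>, so that
  \<open>t\<^sub>k = T $$ (k - 1, 0)\<close>. The two vectors below are \<open>(t\<^sub>3, t\<^sub>4, \<dots>, t\<^sub>m, 0, 0)\<close> and
  \<open>(0, 0, t\<^sub>m, \<dots>, t\<^sub>4, t\<^sub>3)\<close>; for \<open>m \<le> 2\<close> both vanish.
\<close>

definition tau_mat :: "real mat \<Rightarrow> real mat" where
  "tau_mat T =
    (let m = dim_row T in
     T - hankel_mat m
           (vec m (\<lambda>j. if j + 2 < m then T $$ (j + 2, 0) else 0))
           (vec m (\<lambda>j. if 2 \<le> j then T $$ (m + 1 - j, 0) else 0)))"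

definition kronecker :: "real mat \<Rightarrow> real mat \<Rightarrow> real mat" (infixl "\<otimes>\<^sub>K" 70) where
  "A \<otimes>\<^sub>K B = mat (dim_row A * dim_row B) (dim_col A * dim_col B)
     (\<lambda>(j, k). A $$ (j div dim_row B, k div dim_col B) * B $$ (j mod dim_row B, k mod dim_col B))"

definition anti_id :: "nat \<Rightarrow> real mat" where
  "anti_id m = mat m m (\<lambda>(j, k). if j + k + 1 = m then 1 else 0)"

definition at_level :: "nat \<Rightarrow> (nat \<Rightarrow> nat) \<Rightarrow> nat \<Rightarrow> real mat \<Rightarrow> real mat" where
  "at_level d n i X = 1\<^sub>m (\<Prod>j = 1..<i. n j) \<otimes>\<^sub>K X \<otimes>\<^sub>K 1\<^sub>m (\<Prod>j = i + 1..d. n j)"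

definition level_sum :: "nat \<Rightarrow> nat \<Rightarrow> (nat \<Rightarrow> real mat) \<Rightarrow> real mat" where
  "level_sum N d F = foldr (\<lambda>i S. F i + S) [1..<d + 1] (0\<^sub>m N N)"

definition multi_anti_id :: "nat \<Rightarrow> (nat \<Rightarrow> nat) \<Rightarrow> real mat" where
  "multi_anti_id d n = foldr (\<lambda>i Y. anti_id (n i) \<otimes>\<^sub>K Y) [1..<d + 1] (1\<^sub>m 1)"

definition A_mat ::
  "nat \<Rightarrow> (nat \<Rightarrow> nat) \<Rightarrow> (nat \<Rightarrow> real) \<Rightarrow> real \<Rightarrow> (nat \<Rightarrow> real) \<Rightarrow> (nat \<Rightarrow> real) \<Rightarrow> real mat" where
  "A_mat d n \<alpha> \<nu> vp vm =
    (let N = (\<Prod>i = 1..d. n i);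
         W = (\<lambda>i. at_level d n i (L_mat (\<alpha> i) (n i)))
     in \<nu> \<cdot>\<^sub>m 1\<^sub>m N + level_sum N d (\<lambda>i. vp i \<cdot>\<^sub>m W i + vm i \<cdot>\<^sub>m transpose_mat (W i)))"

definition P_mat ::
  "nat \<Rightarrow> (nat \<Rightarrow> nat) \<Rightarrow> (nat \<Rightarrow> real) \<Rightarrow> real \<Rightarrow> (nat \<Rightarrow> real) \<Rightarrow> (nat \<Rightarrow> real) \<Rightarrow> real mat" where
  "P_mat d n \<alpha> \<nu> vp vm =
    (let N = (\<Prod>i = 1..d. n i)
     in \<nu> \<cdot>\<^sub>m 1\<^sub>m N +
        level_sum N d (\<lambda>i. (vp i + vm i) \<cdot>\<^sub>m at_level d n i (tau_mat (sym_part (L_mat (\<alpha> i) (n i))))))"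

end

theory Submission
  imports "HOL-Analysis.Generalised_Binomial_Theorem" Defs
begin

text \<open>
  If \<open>x\<close> is an eigenvector of \<open>P\<^sup>-\<^sup>1 Y A\<close> for \<open>\<lambda>\<close>, then \<open>Y A x = \<lambda> P x\<close>, where \<open>Y A\<close> is symmetric and
  \<open>P\<close> is symmetric, positive definite and commutes with \<open>Y\<close>; hence \<open>\<lambda>\<close> is real and \<open>x\<close> may be
  taken real. Put \<open>y = Y x\<close>, so that \<open>y\<^sup>T P y = x\<^sup>T P x\<close>. Testing with \<open>y\<close> gives
  \<open>\<lambda> x\<^sup>T P x = y\<^sup>T A x\<close>, which bounds \<open>\<bar>\<lambda>\<bar>\<close> from above, and testing with \<open>x\<close> gives
  \<open>\<lambda> x\<^sup>T P y = x\<^sup>T A x\<close>, which bounds it from below. Both bounds reduce, level by level, to two facts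
  about the one-level matrix \<open>L\<close>. First, its symmetric part lies between \<open>\<tau>(\<H>(L)) / 2\<close> and
  \<open>3 \<tau>(\<H>(L)) / 2\<close>, because \<open>\<tau>(\<H>(L))\<close> dominates twice the Hankel correction by diagonal
  dominance. Second, its symbol
  \<open>- e\<^bsup>-i\<theta>\<^esup> (\<alpha> / 2 + (2 - \<alpha>) / 2 e\<^bsup>i\<theta>\<^esup>) (1 - e\<^bsup>i\<theta>\<^esup>)\<^bsup>\<alpha>\<^esup>\<close> takes values in the sector
  \<open>\<bar>Im f\<bar> \<le> \<bar>tan (\<alpha> \<pi> / 2)\<bar> Re f\<close>, hence so does the numerical range of \<open>L\<close>. The inequalities are
  strict because the summand \<open>\<nu> I\<close> of \<open>A\<close> and \<open>P\<close> is positive definite, and the finite spectrum leaves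
  room for an \<open>\<epsilon>\<close> strictly below the maximum.
\<close>

unbundle no vec_syntax
unbundle no inner_syntax

subsection \<open>The coefficients and the symbol\<close>

text \<open>The recursion of \<open>g_coeff\<close> is that of the binomial coefficients of
  \<open>a\<close> up to sign. The identity is complex because the series is evaluated at complex
  \<open>z\<close>.\<close>

lemma g_coeff_gbinomial:
  "complex_of_real (g_coeff a k) = (- 1) ^ k * (complex_of_real a gchoose k)"
proof (induction k)
  case (Suc k)
  let ?c = "complex_of_real a gchoose Suc k" and ?b = "complex_of_real a gchoose k"
  have "of_nat (Suc k) * ?c = (of_real a - of_nat k) * ?b"
    using gbinomial_mult_1[of "complex_of_real a" k] by (simp add: algebra_simps)
  moreover have nz: "complex_of_nat (Suc k) \<noteq> 0"
    by (simp del: of_nat_Suc)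
  ultimately have "?c = (of_real a - of_nat k) / of_nat (Suc k) * ?b"
    by (simp add: field_simps del: of_nat_Suc)
  moreover have "complex_of_real (1 - (a + 1) / real (Suc k)) = - ((of_real a - of_nat k) / of_nat (Suc k))"
    using nz by (simp add: divide_simps del: of_nat_Suc) (simp add: algebra_simps)
  ultimately show ?case
    by (simp only: g_coeff.simps of_real_mult Suc) simp
qed simp

lemma g_coeff_sums:
  assumes "norm z < 1"
  shows "(\<lambda>k. complex_of_real (g_coeff a k) * z ^ k) sums ((1 - z) powr complex_of_real a)"
proof -
  have "(\<lambda>k. (complex_of_real a gchoose k) * (- z) ^ k) sums ((1 + - z) powr complex_of_real a)"
    using assms by (intro gen_binomial_complex) simp
  moreover have "(complex_of_real a gchoose k) * (- z) ^ k = complex_of_real (g_coeff a k) * z ^ k" for k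
    unfolding g_coeff_gbinomial by (subst power_minus) (simp add: mult_ac)
  ultimately show ?thesis
    by simp
qed

text \<open>\<open>w_coeff\<close> mixes \<open>g_coeff\<close> with its shift by one, so its
  generating function is that of \<open>g_coeff\<close> times a linear factor.\<close>

lemma w_coeff_sums:
  assumes "norm z < 1"
  shows "(\<lambda>k. complex_of_real (w_coeff a k) * z ^ k) sums
    ((of_real (a / 2) + of_real ((2 - a) / 2) * z) * (1 - z) powr complex_of_real a)"
proof -
  let ?F = "(1 - z) powr complex_of_real a"
  note g = g_coeff_sums[OF assms, of a]
  \<comment> \<open>The shifted series is padded by \<open>f 0 = 0\<close>, since
    \<open>k - 1\<close> is \<open>0\<close> at \<open>k = 0\<close>.\<close>
  define f where "f k = (if k = 0 then 0
    else of_real ((2 - a) / 2) * z * (complex_of_real (g_coeff a (k - 1)) * z ^ (k - 1)))" for k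
  have "(\<lambda>k. f (Suc k)) sums (of_real ((2 - a) / 2) * z * ?F)"
    unfolding f_def using sums_mult[OF g, of "of_real ((2 - a) / 2) * z"] by simp
  from sums_add[OF sums_mult[OF g, of "of_real (a / 2)"] sums_Suc[OF this]]
  have "(\<lambda>k. of_real (a / 2) * (complex_of_real (g_coeff a k) * z ^ k) + f k) sums
    (of_real (a / 2) * ?F + (of_real ((2 - a) / 2) * z * ?F + f 0))" .
  moreover have "of_real (a / 2) * (complex_of_real (g_coeff a k) * z ^ k) + f k
      = complex_of_real (w_coeff a k) * z ^ k" for k
    by (cases k) (simp_all add: f_def algebra_simps add_divide_distrib diff_divide_distrib del: g_coeff.simps(2))
  ultimately show ?thesis
    by (simp add: f_def algebra_simps)
qed

section \<open>Signs, monotonicity and summability of the coefficients\<close>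

lemma g_coeff_partial_sum:
  assumes "a \<noteq> 0"
  shows "(\<Sum>k\<le>n. g_coeff a k) = - real (Suc n) / a * g_coeff a (Suc n)"
proof (induction n)
  case (Suc n)
  have "(\<Sum>k\<le>Suc n. g_coeff a k) = (1 - real (Suc n) / a) * g_coeff a (Suc n)"
    using Suc by (simp add: algebra_simps del: g_coeff.simps of_nat_Suc)
  also have "\<dots> = - real (Suc (Suc n)) / a * g_coeff a (Suc (Suc n))"
    unfolding g_coeff.simps(2)[of a "Suc n"]
    using assms by (simp add: divide_simps del: g_coeff.simps) (simp add: algebra_simps del: g_coeff.simps)
  finally show ?case .
qed (use assms in simp)

lemma g_coeff_nonneg:
  assumes "1 < a" "a < 2" "2 \<le> k"
  shows "0 \<le> g_coeff a k"
  using assms(3)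
proof (induction rule: dec_induct)
  case base
  have "g_coeff a 2 = a * (a - 1) / 2"
    by (simp add: numeral_2_eq_2 algebra_simps add_divide_distrib)
  moreover have "0 \<le> a * (a - 1)"
    using assms by simp
  ultimately show ?case by simp
next
  case (step k)
  then show ?case using assms by (simp add: divide_simps)
qed

lemma g_coeff_Suc_le:
  assumes "1 < a" "a < 2" "2 \<le> k"
  shows "g_coeff a (Suc k) \<le> g_coeff a k"
  unfolding g_coeff.simps
  using g_coeff_nonneg[OF assms] assms
  by (intro mult_left_le_one_le) (simp_all add: divide_simps)

lemma w_coeff_nonneg:
  assumes "1 < a" "a < 2" "3 \<le> k"
  shows "0 \<le> w_coeff a k"
  using g_coeff_nonneg[OF assms(1,2), of k] g_coeff_nonneg[OF assms(1,2), of "k - 1"] assms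
  by (cases k) (auto simp del: g_coeff.simps)

lemma w_coeff_Suc_le:
  assumes "1 < a" "a < 2" "3 \<le> k"
  shows "w_coeff a (Suc k) \<le> w_coeff a k"
proof -
  obtain j where k: "k = Suc j" using assms(3) by (cases k) auto
  have "a / 2 * g_coeff a (Suc k) \<le> a / 2 * g_coeff a k"
    using assms by (intro mult_left_mono g_coeff_Suc_le) auto
  moreover have "(2 - a) / 2 * g_coeff a k \<le> (2 - a) / 2 * g_coeff a j"
    unfolding k using assms k by (intro mult_left_mono g_coeff_Suc_le) auto
  ultimately show ?thesis
    unfolding k by (simp del: g_coeff.simps)
qed

text \<open>As \<open>a / 2 + (2 - a) / 2 = 1\<close>, this is a convex combination of two
  consecutive partial sums of \<open>g_coeff\<close>. Their closed form makes them nonpositive from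
  index 1 on, and \<open>2 \<le> n\<close> keeps both indices in that range.\<close>

lemma w_coeff_partial_sum_nonpos:
  assumes "1 < a" "a < 2" "2 \<le> n"
  shows "(\<Sum>k\<le>n. w_coeff a k) \<le> 0"
proof -
  have G: "(\<Sum>k\<le>j. g_coeff a k) \<le> 0" if "1 \<le> j" for j
    using g_coeff_nonneg[of a "Suc j"] assms that
    by (simp add: g_coeff_partial_sum divide_simps mult_nonneg_nonneg del: g_coeff.simps of_nat_Suc)
  have *: "(\<Sum>k\<le>Suc j. w_coeff a k)
      = a / 2 * (\<Sum>k\<le>Suc j. g_coeff a k) + (2 - a) / 2 * (\<Sum>k\<le>j. g_coeff a k)" for j
    by (induction j) (simp_all add: algebra_simps del: g_coeff.simps(2))
  obtain j where j: "n = Suc j" "1 \<le> j" using assms(3) by (cases n) auto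
  show ?thesis
    unfolding j(1) * using G[of j] G[of "Suc j"] j assms
    by (intro add_nonpos_nonpos mult_nonneg_nonpos) auto
qed

text \<open>The coefficients are nonnegative from index 3 on, while the full partial sums stay
  nonpositive; so the tail can at most compensate the first three coefficients.\<close>

lemma summable_w_coeff:
  assumes "1 < a" "a < 2"
  shows "summable (\<lambda>k. \<bar>w_coeff a k\<bar>)"
proof -
  have *: "(\<Sum>k<n. w_coeff a (k + 3)) = (\<Sum>k\<le>n + 2. w_coeff a k) - (\<Sum>k\<le>2. w_coeff a k)" for n
    by (induction n) (simp_all add: eval_nat_numeral del: w_coeff.simps)
  have "summable (\<lambda>k. w_coeff a (k + 3))"
  proof (rule summableI_nonneg_bounded)
    show "(\<Sum>k<n. w_coeff a (k + 3)) \<le> - (\<Sum>k\<le>2. w_coeff a k)" for n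
      using w_coeff_partial_sum_nonpos[OF assms, of "n + 2"] unfolding * by linarith
  qed (use w_coeff_nonneg[OF assms] in simp)
  then have "summable (\<lambda>k. \<bar>w_coeff a (k + 3)\<bar>)"
    using w_coeff_nonneg[OF assms] by simp
  then show ?thesis
    by (subst (asm) summable_iff_shift)
qed


text \<open>An Abel limit along the radius to \<open>z\<close>: the M-test makes the series
  continuous in \<open>r\<close> up to 1, and the closed form is continuous there because
  \<open>1 - z\<close> avoids the branch cut of the power.\<close>

lemma w_coeff_sums_on_circle:
  assumes a: "1 < a" "a < 2" and z: "norm z = 1" "z \<noteq> 1"
  shows "(\<lambda>k. complex_of_real (w_coeff a k) * z ^ k) sums
    ((of_real (a / 2) + of_real ((2 - a) / 2) * z) * (1 - z) powr complex_of_real a)"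
proof -
  let ?f = "\<lambda>k r. complex_of_real (w_coeff a k) * (of_real r * z) ^ k"
  let ?W = "\<lambda>y. (of_real (a / 2) + of_real ((2 - a) / 2) * y) * (1 - y) powr complex_of_real a"
  have le: "norm (?f k r) \<le> \<bar>w_coeff a k\<bar>" if "r \<in> {0..1}" for k r
    using that z by (auto simp: norm_mult norm_power power_le_one mult_left_le)
  have ul: "uniform_limit {0..1} (\<lambda>n r. \<Sum>k<n. ?f k r) (\<lambda>r. \<Sum>k. ?f k r) sequentially"
    using le summable_w_coeff[OF a] by (rule Weierstrass_m_test)
  have "continuous_on {0..1} (\<lambda>r. \<Sum>k. ?f k r)"
    by (rule uniform_limit_theorem[OF _ ul]) (auto intro!: always_eventually continuous_intros)
  then have "((\<lambda>r. \<Sum>k. ?f k r) \<longlongrightarrow> (\<Sum>k. ?f k 1)) (at 1 within {0..1})"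
    unfolding continuous_on_def by (rule bspec) simp
  then have "((\<lambda>r. \<Sum>k. ?f k r) \<longlongrightarrow> (\<Sum>k. ?f k 1)) (at 1 within {0..<1})"
    by (rule tendsto_within_subset) auto
  moreover have "(\<Sum>k. ?f k r) = ?W (of_real r * z)" if "r \<in> {0..<1}" for r
    using that z by (intro sums_unique[symmetric] w_coeff_sums) (auto simp: norm_mult)
  ultimately have "((\<lambda>r. ?W (of_real r * z)) \<longlongrightarrow> (\<Sum>k. ?f k 1)) (at 1 within {0..<1})"
    by (elim Lim_transform_eventually) (auto simp: eventually_at_filter)
  then have "((\<lambda>r. ?W (of_real r * z)) \<longlongrightarrow> (\<Sum>k. ?f k 1)) (at_left 1)"
    by (subst (asm) at_within_nhd[of 1 "{0<..}" "{0..<1}" "{..<1}"]) auto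
  moreover have "1 - z \<notin> \<real>\<^sub>\<le>\<^sub>0"
  proof
    assume "1 - z \<in> \<real>\<^sub>\<le>\<^sub>0"
    then have "Re z \<ge> 1" "Im z = 0"
      by (auto simp: complex_nonpos_Reals_iff)
    then show False
      using z abs_Re_le_cmod[of z] by (auto simp: complex_eq_iff)
  qed
  then have "((\<lambda>r. ?W (of_real r * z)) \<longlongrightarrow> ?W (of_real 1 * z)) (at_left 1)"
    by (intro tendsto_intros) auto
  ultimately have "(\<Sum>k. ?f k 1) = ?W (of_real 1 * z)"
    by (intro tendsto_unique[OF _ _ _]) auto
  moreover have "summable (\<lambda>k. ?f k 1)"
    using le[of 1] by (intro summable_comparison_test[OF _ summable_w_coeff[OF a]]) auto
  ultimately show ?thesis
    by (simp add: sums_iff)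
qed

section \<open>The sector containing the symbol\<close>

lemma sin_mult_le_sin_mult:
  fixes b c t :: real
  assumes "0 \<le> b" "b \<le> c" "0 \<le> t" "c * t \<le> pi"
  shows "b * sin (c * t) \<le> c * sin (b * t)"
proof -
  let ?f = "\<lambda>t. c * sin (b * t) - b * sin (c * t)"
  have "?f 0 \<le> ?f t"
  proof (rule DERIV_nonneg_imp_nondecreasing[OF assms(3)])
    fix s assume s: "0 \<le> s" "s \<le> t"
    have "c * s \<le> c * t" using s assms by (intro mult_left_mono) auto
    then have "cos (c * s) \<le> cos (b * s)"
      using s assms by (intro cos_monotone_0_pi_le) (auto intro: mult_right_mono)
    then have "0 \<le> c * b * (cos (b * s) - cos (c * s))"
      using assms by simp
    moreover have "(?f has_real_derivative c * b * (cos (b * s) - cos (c * s))) (at s)"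
      by (auto intro!: derivative_eq_intros simp: algebra_simps)
    ultimately show "\<exists>y. (?f has_real_derivative y) (at s) \<and> 0 \<le> y"
      by blast
  qed
  then show ?thesis by simp
qed

text \<open>With \<open>b = 2 - a\<close> and \<open>t = pi / 2 - \<bar>p\<bar>\<close>, multiplying
  by the cosine in the tangent and using the addition theorems leaves
  \<open>b * sin (a * t) \<le> a * sin (b * t)\<close>. Equality holds at
  \<open>t = 0\<close>.\<close>

lemma symbol_sector_real:
  fixes a p :: real
  assumes a: "1 < a" "a < 2" and p: "\<bar>p\<bar> \<le> pi / 2"
  shows "\<bar>a * sin ((2 - a) * p) + (2 - a) * sin (a * p)\<bar>
    \<le> \<bar>tan (a / 2 * pi)\<bar> * (a * cos ((2 - a) * p) - (2 - a) * cos (a * p))"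
proof -
  define b where "b = 2 - a"
  define q where "q = \<bar>p\<bar>"
  define t where "t = pi / 2 - q"
  have b: "0 < b" "b < 1" and q: "0 \<le> q" "q \<le> pi / 2" and t: "0 \<le> t" "t \<le> pi / 2"
    using a p by (auto simp: b_def q_def t_def)
  have ct: "a * t \<le> pi"
    using mult_mono[of a 2 t "pi / 2"] a t by simp
  have c0: "0 < cos (b * pi / 2)" 
    using b by (intro cos_gt_zero) auto
  have s0: "0 < sin (b * pi / 2)"
    using b by (intro sin_gt_zero) (auto simp: field_simps)
  \<comment> \<open>The angle lies in the second quadrant; reflecting it gives an acute angle with
    positive sine and cosine.\<close>
  have "tan (a / 2 * pi) = tan (pi - b * pi / 2)"
    unfolding b_def by (simp add: field_simps)
  also have "\<dots> = - tan (b * pi / 2)"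
    by (simp add: tan_def)
  finally have tan: "\<bar>tan (a / 2 * pi)\<bar> = sin (b * pi / 2) / cos (b * pi / 2)"
    using c0 s0 by (simp add: tan_def)
  have abs: "\<bar>a * sin (b * p) + b * sin (a * p)\<bar> = a * sin (b * q) + b * sin (a * q)"
  proof -
    have "b * q \<le> pi / 2" "a * q \<le> pi"
      using mult_mono[of b 1 q "pi / 2"] mult_mono[of a 2 q "pi / 2"] a b q by auto
    then have "0 \<le> sin (b * q)" "0 \<le> sin (a * q)"
      using a b q by (auto intro!: sin_ge_zero)
    then have *: "0 \<le> a * sin (b * q) + b * sin (a * q)"
      using a b by simp
    show ?thesis
    proof (cases "0 \<le> p")
      case False
      then have "p = - q" by (simp add: q_def)
      then show ?thesis using * by simp
    qed (use * in \<open>simp add: q_def\<close>)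
  qed
  have cos: "cos (b * p) = cos (b * q)" "cos (a * p) = cos (a * q)"
    by (auto simp: q_def abs_if)
  have "a * (sin (b * q) * cos (b * pi / 2) - cos (b * q) * sin (b * pi / 2))
      + b * (sin (a * q) * cos (b * pi / 2) + cos (a * q) * sin (b * pi / 2))
      = a * sin (b * q - b * pi / 2) + b * sin (a * q + b * pi / 2)"
    by (simp add: sin_add sin_diff)
  also have "b * q - b * pi / 2 = - (b * t)"
    unfolding t_def by (simp add: field_simps)
  also have "a * q + b * pi / 2 = pi - a * t"
    unfolding t_def b_def by (simp add: field_simps)
  also have "a * sin (- (b * t)) + b * sin (pi - a * t) \<le> 0"
    using sin_mult_le_sin_mult[of b a t] a b t ct by (simp add: b_def)
  finally have "(a * sin (b * q) + b * sin (a * q)) * cos (b * pi / 2)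
      \<le> sin (b * pi / 2) * (a * cos (b * q) - b * cos (a * q))"
    by (simp add: algebra_simps)
  then show ?thesis
    unfolding b_def[symmetric] abs cos tan using c0 by (simp add: field_simps)
qed

text \<open>In polar form \<open>1 - z\<close> has modulus \<open>2 * cos p\<close> and argument
  \<open>p\<close>, so the power has argument \<open>a * p\<close> and a positive modulus that
  factors out of the claim. The factor \<open>- cnj z\<close> stems from the sign and the index
  shift in the entries \<open>- w_coeff a (j + 1 - k)\<close>.\<close>

lemma symbol_sector:
  fixes a :: real
  assumes a: "1 < a" "a < 2" and z: "norm z = 1" "z \<noteq> 1"
  defines "f \<equiv> - cnj z * ((of_real (a / 2) + of_real ((2 - a) / 2) * z) * (1 - z) powr complex_of_real a)"
  shows "\<bar>Im f\<bar> \<le> \<bar>tan (a / 2 * pi)\<bar> * Re f"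
proof -
  \<comment> \<open>Half the argument of \<open>- z\<close>. Since \<open>z \<noteq> 1\<close>, it
    lies strictly between \<open>- pi / 2\<close> and \<open>pi / 2\<close>, so \<open>cos p\<close>
    is positive and the principal logarithm of \<open>1 - z\<close> has imaginary part
    \<open>p\<close>.\<close>
  define p where "p = Arg (- z) / 2"
  define u where "u = (2 - a) * p"
  have mz: "- z = cis (2 * p)"
    using z cis_Arg[of "- z"] by (cases "z = 0") (auto simp: p_def sgn_eq)
  have p: "- (pi / 2) < p" "p < pi / 2"
  proof -
    have "Arg (- z) \<noteq> pi"
      using z(2) mz by (auto simp: p_def)
    then show "- (pi / 2) < p" "p < pi / 2"
      using mpi_less_Arg[of "- z"] Arg_le_pi[of "- z"] by (auto simp: p_def)
  qed
  have c: "0 < cos p"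
    using p by (intro cos_gt_zero_pi) auto
  define r where "r = 2 * cos p"
  have r: "0 < r" using c by (simp add: r_def)
  have "1 - z = 1 + cis (2 * p)"
    using mz by simp
  also have "\<dots> = of_real r * cis p"
    by (simp add: r_def complex_eq_iff cos_double_cos sin_double power2_eq_square)
  also have "\<dots> = exp (Complex (ln r) p)"
    using r by (simp add: exp_eq_polar complex_of_real_def[symmetric])
  finally have oz: "1 - z = exp (Complex (ln r) p)" .
  then have "(1 - z) powr complex_of_real a = exp (of_real a * Complex (ln r) p)"
    using p pi_gt_zero by (simp add: powr_def Ln_exp)
  also have "\<dots> = of_real (r powr a) * cis (a * p)"
    using r by (simp add: exp_eq_polar powr_def)
  finally have pw: "(1 - z) powr complex_of_real a = of_real (r powr a) * cis (a * p)" .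
  have z': "z = - cis (2 * p)"
    using mz by (metis minus_minus)
  have "cis (- (2 * p)) * cis (2 * p) = 1"
    by (simp add: cis_mult)
  then have "- cnj z * (A + B * z) = A * cis (- (2 * p)) - B" for A B
    unfolding z' by (simp add: cis_cnj algebra_simps)
  then have "f = (of_real (a / 2) * cis (- (2 * p)) - of_real ((2 - a) / 2)) * (of_real (r powr a) * cis (a * p))"
    unfolding f_def pw by (metis mult.assoc)
  also have "\<dots> = of_real (r powr a / 2) *
      (of_real a * (cis (- (2 * p)) * cis (a * p)) - of_real (2 - a) * cis (a * p))"
    by (simp add: algebra_simps add_divide_distrib diff_divide_distrib)
  also have "cis (- (2 * p)) * cis (a * p) = cis (- u)"
    by (simp add: u_def cis_mult algebra_simps)
  finally have f: "f = of_real (r powr a / 2) *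
      (of_real a * cis (- u) - of_real (2 - a) * cis (a * p))" .
  have im: "Im f = - (r powr a / 2 * (a * sin u + (2 - a) * sin (a * p)))"
    unfolding f by (simp add: algebra_simps)
  have re: "Re f = r powr a / 2 * (a * cos u - (2 - a) * cos (a * p))"
    unfolding f by simp
  have "\<bar>a * sin u + (2 - a) * sin (a * p)\<bar>
    \<le> \<bar>tan (a / 2 * pi)\<bar> * (a * cos u - (2 - a) * cos (a * p))"
    unfolding u_def using p by (intro symbol_sector_real[OF a]) auto
  from mult_left_mono[OF this, of "r powr a / 2"] show ?thesis
    unfolding im re abs_minus_cancel abs_mult by (simp add: mult.left_commute)
qed


subsection \<open>The numerical range of the Toeplitz matrix\<close>

text \<open>The shift by half a step keeps the nodes away from \<open>1\<close>, where \<open>1 - z\<close> vanishes.\<close>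

lemma sum_roots_of_unity_half_shifted:
  fixes a b K :: nat
  defines "z \<equiv> \<lambda>k. cis (real (2 * k + 1) * pi / real K)"
  assumes K: "0 < K" and ab: "a < b + K" "b < a + K"
  shows "(\<Sum>k<K. z k ^ a * cnj (z k) ^ b) = (if a = b then of_nat K else 0)"
proof (cases "a = b")
  case True
  have "z k ^ a * cnj (z k) ^ a = 1" for k
    unfolding power_mult_distrib[symmetric] by (simp add: z_def complex_norm_square[symmetric])
  then show ?thesis
    using True by simp
next
  case False
  define j where "j = real a - real b"
  define w where "w = cis (2 * pi * j / K)"
  have "z k ^ a * cnj (z k) ^ b = cis (j * pi / K) * w ^ k" for k
    unfolding z_def w_def cis_cnj Complex.DeMoivre cis_mult j_def
    using K by (intro arg_cong[where f = cis]) (simp add: field_simps)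
  then have "(\<Sum>k<K. z k ^ a * cnj (z k) ^ b) = cis (j * pi / K) * (\<Sum>k<K. w ^ k)"
    by (simp add: sum_distrib_left)
  also have "(\<Sum>k<K. w ^ k) = 0"
  proof -
    have "w \<noteq> 1"
    proof
      assume "w = 1"
      then have "cos (2 * pi * j / K) = 1"
        by (simp add: w_def complex_eq_iff)
      then obtain i :: int where "2 * pi * j / K = of_int i * 2 * pi"
        by (auto simp: cos_one_2pi_int)
      then have "j = of_int i * real K"
        using K by (simp add: field_simps)
      then have i: "int a - int b = i * int K"
        unfolding j_def by (metis (mono_tags) of_int_diff of_int_eq_iff of_int_mult of_int_of_nat_eq)
      have "\<bar>i * int K\<bar> < int K"
        unfolding i[symmetric] using ab by linarith
      then have "\<bar>i\<bar> * int K < int K"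
        by (simp add: abs_mult)
      then have "i = 0"
        using K by (simp add: mult_less_cancel_right1)
      then show False using False i by simp
    qed
    moreover have "w ^ K = 1"
      unfolding w_def Complex.DeMoivre using K cis_multiple_2pi[of j]
      by (auto simp: j_def cis_multiple_2pi mult_ac)
    ultimately show ?thesis
      by (simp add: sum_gp_strict)
  qed
  finally show ?thesis
    using False by simp
qed

text \<open>
  The quadratic form is an average of the truncated symbol over sufficiently many roots of unity;
  since the coefficients are absolutely summable, the truncation error tends to 0 uniformly on the
  unit circle.
\<close>

lemma L_mat_numerical_range:
  fixes v :: "nat \<Rightarrow> complex" and m :: nat
  assumes a: "1 < a" "a < 2"
  defines "Q \<equiv> \<Sum>q<m. \<Sum>p<m. of_real (L_mat a m $$ (q, p)) * cnj (v q) * v p"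
  shows "\<bar>Im Q\<bar> \<le> \<bar>tan (a / 2 * pi)\<bar> * Re Q"
proof -
  let ?w = "w_coeff a"
  let ?t = "\<bar>tan (a / 2 * pi)\<bar>"
  define V where "V z = (\<Sum>p<m. v p * z ^ p)" for z :: complex
  define C where "C = (\<Sum>p<m. norm (v p))\<^sup>2"
  \<comment> \<open>The tail of the absolute series bounds the error of truncating the symbol after
    \<open>N\<close> terms.\<close>
  define \<delta> where "\<delta> N = (\<Sum>l. \<bar>?w l\<bar>) - (\<Sum>l<N. \<bar>?w l\<bar>)" for N
  have sw: "summable (\<lambda>l. \<bar>?w l\<bar>)"
    by (rule summable_w_coeff[OF a])
  have \<delta>0: "\<delta> \<longlonglongrightarrow> 0"
    using tendsto_diff[OF tendsto_const[of "\<Sum>l. \<bar>?w l\<bar>"] summable_LIMSEQ[OF sw]]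
    by (simp add: \<delta>_def[abs_def])
  \<comment> \<open>Entries of \<open>L_mat a m\<close> use coefficients up to index
    \<open>m\<close> only, so \<open>N \<ge> m + 1\<close> terms contain them all.\<close>
  have main: "\<bar>Im Q\<bar> \<le> ?t * Re Q + (1 + ?t) * \<delta> N * C" if N: "N \<ge> m + 1" for N
  proof -
    \<comment> \<open>Enough nodes to exclude aliasing: the exponents \<open>l + p\<close> and
      \<open>q + 1\<close> below differ by less than \<open>K\<close>.\<close>
    define K where "K = N + m + 2"
    define z where "z k = cis (real (2 * k + 1) * pi / real K)" for k
    define f where "f k = - cnj (z k) * (\<Sum>l<N. of_real (?w l) * z k ^ l)" for k
    have K0: "0 < K" by (simp add: K_def)
    have orth: "(\<Sum>k<K. z k ^ i * cnj (z k) ^ j) = (if i = j then of_nat K else 0)"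
      if "i < j + K" "j < i + K" for i j
      unfolding z_def using that by (intro sum_roots_of_unity_half_shifted) (auto simp: K_def)
    have "(\<Sum>k<K. f k * (V (z k) * cnj (V (z k))))
        = (\<Sum>k<K. \<Sum>l<N. \<Sum>p<m. \<Sum>q<m. - of_real (?w l) * v p * cnj (v q) * (z k ^ (l + p) * cnj (z k) ^ (q + 1)))"
    proof (rule sum.cong[OF refl])
      fix k
      have "f k * (V (z k) * cnj (V (z k))) = (\<Sum>l<N. - cnj (z k) * (of_real (?w l) * z k ^ l)) *
          ((\<Sum>p<m. v p * z k ^ p) * (\<Sum>q<m. cnj (v q) * cnj (z k) ^ q))"
        unfolding f_def V_def by (simp add: sum_distrib_left)
      also have "\<dots> = (\<Sum>l<N. \<Sum>p<m. \<Sum>q<m. - cnj (z k) * (of_real (?w l) * z k ^ l) *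
          ((v p * z k ^ p) * (cnj (v q) * cnj (z k) ^ q)))"
        unfolding sum_product unfolding sum_distrib_left ..
      finally show "f k * (V (z k) * cnj (V (z k)))
          = (\<Sum>l<N. \<Sum>p<m. \<Sum>q<m. - of_real (?w l) * v p * cnj (v q) * (z k ^ (l + p) * cnj (z k) ^ (q + 1)))"
        by (simp add: power_add mult_ac)
    qed
    also have "\<dots> = (\<Sum>l<N. \<Sum>p<m. \<Sum>q<m. - of_real (?w l) * v p * cnj (v q) * (\<Sum>k<K. z k ^ (l + p) * cnj (z k) ^ (q + 1)))"
      unfolding sum_distrib_left
      by (subst sum.swap, rule sum.cong[OF refl], subst sum.swap, rule sum.cong[OF refl], rule sum.swap)
    \<comment> \<open>Orthogonality keeps only \<open>l = q + 1 - p\<close>, the coefficient index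
      of the Toeplitz entry at \<open>(q, p)\<close>.\<close>
    also have "\<dots> = (\<Sum>l<N. \<Sum>p<m. \<Sum>q<m. - of_real (?w l) * v p * cnj (v q) * (if l + p = q + 1 then of_nat K else 0))"
      by (intro sum.cong refl, subst orth) (auto simp: K_def)
    also have "\<dots> = (\<Sum>p<m. \<Sum>q<m. \<Sum>l<N. - of_real (?w l) * v p * cnj (v q) * (if l + p = q + 1 then of_nat K else 0))"
      by (subst sum.swap, rule sum.cong[OF refl], rule sum.swap)
    also have "\<dots> = (\<Sum>p<m. \<Sum>q<m. of_nat K * (of_real (L_mat a m $$ (q, p)) * cnj (v q) * v p))"
    proof (intro sum.cong refl)
      fix p q assume pq: "p \<in> {..<m}" "q \<in> {..<m}"
      show "(\<Sum>l<N. - of_real (?w l) * v p * cnj (v q) * (if l + p = q + 1 then of_nat K else 0))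
        = of_nat K * (of_real (L_mat a m $$ (q, p)) * cnj (v q) * v p)"
      proof (cases "p \<le> q + 1")
        case True
        then have iff: "l + p = q + 1 \<longleftrightarrow> l = q + 1 - p" for l by auto
        have "q + 1 - p < N" using pq N by auto
        then show ?thesis
          using True pq unfolding iff by (simp add: L_mat_def if_distrib sum.delta cong: if_cong)
      next
        case False
        then have "l + p \<noteq> q + 1" for l by auto
        then show ?thesis
          using False pq by (simp add: L_mat_def)
      qed
    qed
    also have "\<dots> = of_nat K * Q"
      unfolding Q_def sum_distrib_left by (rule sum.swap)
    finally have KQ: "of_nat K * Q = (\<Sum>k<K. f k * of_real ((norm (V (z k)))\<^sup>2))"
      by (simp only: complex_norm_square)
    have f: "\<bar>Im (f k)\<bar> \<le> ?t * Re (f k) + (1 + ?t) * \<delta> N" if "k < K" for k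
    proof -
      have nz: "norm (z k) = 1" by (simp add: z_def)
      \<comment> \<open>Otherwise the odd number \<open>2 * k + 1\<close> would be an even multiple
        of \<open>K\<close>.\<close>
      have z1: "z k \<noteq> 1"
      proof
        assume "z k = 1"
        then have "cos (real (2 * k + 1) * pi / real K) = 1"
          by (simp add: z_def complex_eq_iff)
        then obtain i :: int where "real (2 * k + 1) * pi / real K = of_int i * 2 * pi"
          by (auto simp: cos_one_2pi_int)
        moreover have "x = of_int i * 2 * real K" if "x * pi / real K = of_int i * 2 * pi" for x
          using that K0 by (simp add: field_simps)
        ultimately have "real (2 * k + 1) = of_int i * 2 * real K"
          by blast
        then have "int (2 * k + 1) = i * 2 * int K"
          by (metis (mono_tags) of_int_eq_iff of_int_mult of_int_numeral of_int_of_nat_eq)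
        then have "even (int (2 * k + 1))" by simp
        then show False by simp
      qed
      \<comment> \<open>The exact symbol lies in the sector. Replacing it by \<open>f k\<close>
        costs at most \<open>\<delta> N\<close> in the imaginary part and the same in the real part,
        hence the factor \<open>1 + ?t\<close>.\<close>
      define W where "W = (of_real (a / 2) + of_real ((2 - a) / 2) * z k) * (1 - z k) powr complex_of_real a"
      define e where "e = f k - (- cnj (z k) * W)"
      have sums: "(\<lambda>l. of_real (?w l) * z k ^ l) sums W"
        unfolding W_def by (rule w_coeff_sums_on_circle[OF a nz z1])
      have nrm: "norm (of_real (?w l) * z k ^ l) = \<bar>?w l\<bar>" for l
        using nz by (simp add: norm_mult norm_power)
      have "e = cnj (z k) * (W - (\<Sum>l<N. of_real (?w l) * z k ^ l))"
        by (simp add: e_def f_def right_diff_distrib)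
      then have "norm e = norm (W - (\<Sum>l<N. of_real (?w l) * z k ^ l))"
        using nz by (simp add: norm_mult)
      also have "W - (\<Sum>l<N. of_real (?w l) * z k ^ l) = (\<Sum>l. of_real (?w (l + N)) * z k ^ (l + N))"
        using sums suminf_minus_initial_segment[of "\<lambda>l. of_real (?w l) * z k ^ l" N]
        by (simp add: sums_iff)
      also have "norm \<dots> \<le> (\<Sum>l. norm (of_real (?w (l + N)) * z k ^ (l + N)))"
        using sw by (intro summable_norm) (simp add: nrm summable_iff_shift[of "\<lambda>l. \<bar>?w l\<bar>" N])
      also have "\<dots> = \<delta> N"
        unfolding nrm \<delta>_def by (rule suminf_minus_initial_segment[OF sw])
      finally have e: "norm e \<le> \<delta> N" .
      have fe: "f k = - cnj (z k) * W + e" by (simp add: e_def)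
      have "\<bar>Im (- cnj (z k) * W)\<bar> \<le> ?t * Re (- cnj (z k) * W)"
        unfolding W_def by (rule symbol_sector[OF a nz z1])
      also have "\<dots> = ?t * Re (f k) - ?t * Re e"
        by (simp add: fe algebra_simps)
      finally have "\<bar>Im (- cnj (z k) * W)\<bar> \<le> ?t * Re (f k) - ?t * Re e" .
      moreover have "- (?t * Re e) \<le> ?t * \<delta> N"
        using mult_left_mono[of "- Re e" "\<delta> N" ?t] e abs_Re_le_cmod[of e] by simp
      moreover have "\<bar>Im (f k)\<bar> \<le> \<bar>Im (- cnj (z k) * W)\<bar> + \<delta> N"
        using e abs_Im_le_cmod[of e] by (simp add: fe)
      ultimately show ?thesis
        by (simp add: algebra_simps)
    qed
    have \<delta>: "0 \<le> \<delta> N"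
      unfolding \<delta>_def using sum_le_suminf[OF sw, of "{..<N}"] by simp
    \<comment> \<open>A bound independent of \<open>N\<close>, so that the error term vanishes in
      the limit.\<close>
    have VC: "(norm (V z))\<^sup>2 \<le> C" if "norm z = 1" for z
      unfolding V_def C_def using that
      by (intro power_mono order.trans[OF norm_sum] sum_mono) (auto simp: norm_mult norm_power)
    have "real K * Im Q = (\<Sum>k<K. Im (f k) * (norm (V (z k)))\<^sup>2)"
      using arg_cong[OF KQ, of Im] by simp
    then have "real K * \<bar>Im Q\<bar> = \<bar>\<Sum>k<K. Im (f k) * (norm (V (z k)))\<^sup>2\<bar>"
      by (metis abs_mult abs_of_nat)
    also have "\<dots> \<le> (\<Sum>k<K. \<bar>Im (f k) * (norm (V (z k)))\<^sup>2\<bar>)"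
      by (rule sum_abs)
    also have "\<dots> \<le> (\<Sum>k<K. ?t * (Re (f k) * (norm (V (z k)))\<^sup>2) + (1 + ?t) * \<delta> N * C)"
    proof (rule sum_mono)
      fix k assume k: "k \<in> {..<K}"
      have "\<bar>Im (f k) * (norm (V (z k)))\<^sup>2\<bar> \<le> (?t * Re (f k) + (1 + ?t) * \<delta> N) * (norm (V (z k)))\<^sup>2"
        using f[of k] k by (simp add: abs_mult mult_right_mono)
      also have "\<dots> \<le> ?t * (Re (f k) * (norm (V (z k)))\<^sup>2) + (1 + ?t) * \<delta> N * C"
        using mult_left_mono[OF VC[of "z k"], of "(1 + ?t) * \<delta> N"] \<delta> by (simp add: z_def algebra_simps)
      finally show "\<bar>Im (f k) * (norm (V (z k)))\<^sup>2\<bar>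
        \<le> ?t * (Re (f k) * (norm (V (z k)))\<^sup>2) + (1 + ?t) * \<delta> N * C" .
    qed
    also have "\<dots> = ?t * (\<Sum>k<K. Re (f k) * (norm (V (z k)))\<^sup>2) + real K * ((1 + ?t) * \<delta> N * C)"
      by (simp only: sum.distrib sum_distrib_left sum_constant card_lessThan)
    also have "(\<Sum>k<K. Re (f k) * (norm (V (z k)))\<^sup>2) = real K * Re Q"
      using arg_cong[OF KQ, of Re] by simp
    finally have "real K * \<bar>Im Q\<bar> \<le> real K * (?t * Re Q + (1 + ?t) * \<delta> N * C)"
      by (simp add: algebra_simps)
    then show ?thesis
      by (simp add: K_def)
  qed
  have "(\<lambda>N. ?t * Re Q + (1 + ?t) * \<delta> N * C) \<longlonglongrightarrow> ?t * Re Q + (1 + ?t) * 0 * C"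
    by (intro tendsto_intros \<delta>0)
  moreover have "\<forall>\<^sub>F N in sequentially. \<bar>Im Q\<bar> \<le> ?t * Re Q + (1 + ?t) * \<delta> N * C"
    using main by (auto simp: eventually_sequentially)
  ultimately have "\<bar>Im Q\<bar> \<le> ?t * Re Q + (1 + ?t) * 0 * C"
    by (intro tendsto_lowerbound) auto
  then show ?thesis by simp
qed

text \<open>The arguments are functions on indices, so that slicing along a level and reversing
  indices are plain compositions.\<close>

definition mat_form :: "real mat \<Rightarrow> (nat \<Rightarrow> real) \<Rightarrow> (nat \<Rightarrow> real) \<Rightarrow> real" where
  "mat_form A x y = (\<Sum>j<dim_row A. \<Sum>k<dim_col A. A $$ (j, k) * x j * y k)"

text \<open>The sector is tested on the complex vector with real part \<open>x\<close> and imaginary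
  part \<open>y\<close>: the imaginary part of its form is the skew difference, the real part is the
  sum on the right.\<close>

lemma L_mat_form_skew_le:
  fixes m :: nat
  assumes a: "1 < a" "a < 2"
  defines "B \<equiv> mat_form (L_mat a m)"
  shows "\<bar>B x y - B y x\<bar> \<le> \<bar>tan (a / 2 * pi)\<bar> * (B x x + B y y)"
proof -
  let ?Q = "\<Sum>q<m. \<Sum>p<m. of_real (L_mat a m $$ (q, p)) * cnj (Complex (x q) (y q)) * Complex (x p) (y p)"
  have "Re ?Q = B x x + B y y" "Im ?Q = B x y - B y x"
    unfolding B_def mat_form_def
    by (simp_all add: L_mat_def sum.distrib sum_subtractf algebra_simps)
  then show ?thesis
    using L_mat_numerical_range[OF a, of m "\<lambda>q. Complex (x q) (y q)"] by simp
qed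


subsection \<open>The one-level Tau matrix\<close>

text \<open>Each off-diagonal product is bounded below by half the sum of the two squares. By
  symmetry the halves add up to the off-diagonal row sums, which the diagonal dominates.\<close>

lemma diagonally_dominant_form_nonneg:
  fixes q :: "nat \<Rightarrow> nat \<Rightarrow> real"
  assumes sym: "\<And>j k. q j k = q k j"
    and dom: "\<And>j. j < m \<Longrightarrow> (\<Sum>k<m. if k = j then 0 else \<bar>q j k\<bar>) \<le> q j j"
  shows "0 \<le> (\<Sum>j<m. \<Sum>k<m. q j k * x j * x k)"
proof -
  define r where "r j k = (if k = j then 0 else \<bar>q j k\<bar>)" for j k
  have le: "(if k = j then q j j * (x j)\<^sup>2 else 0) - r j k * (x j)\<^sup>2 / 2 - r j k * (x k)\<^sup>2 / 2
      \<le> q j k * x j * x k" for j k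
  proof (cases "k = j")
    case False
    have "- (q j k * x j * x k) \<le> \<bar>q j k\<bar> * \<bar>x j * x k\<bar>"
      by (metis abs_ge_minus_self abs_mult mult.assoc)
    also have "\<dots> \<le> \<bar>q j k\<bar> * (((x j)\<^sup>2 + (x k)\<^sup>2) / 2)"
      using sum_squares_bound[of "\<bar>x j\<bar>" "\<bar>x k\<bar>"] by (intro mult_left_mono) (auto simp: abs_mult)
    finally show ?thesis
      using False by (simp add: r_def algebra_simps add_divide_distrib)
  qed (simp add: r_def power2_eq_square)
  have r_sym: "r j k = r k j" for j k
    using sym[of j k] by (simp add: r_def)
  have swap: "(\<Sum>j<m. \<Sum>k<m. r j k * (x k)\<^sup>2 / 2) = (\<Sum>j<m. \<Sum>k<m. r j k * (x j)\<^sup>2 / 2)"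
    by (subst sum.swap) (simp add: r_sym)
  have "0 \<le> (\<Sum>j<m. (q j j - (\<Sum>k<m. r j k)) * (x j)\<^sup>2)"
    using dom by (intro sum_nonneg mult_nonneg_nonneg) (auto simp: r_def)
  also have "\<dots> = (\<Sum>j<m. q j j * (x j)\<^sup>2) - 2 * (\<Sum>j<m. \<Sum>k<m. r j k * (x j)\<^sup>2 / 2)"
    by (simp add: sum_subtractf left_diff_distrib sum_distrib_right sum_divide_distrib[symmetric])
  also have "\<dots> = (\<Sum>j<m. \<Sum>k<m. (if k = j then q j j * (x j)\<^sup>2 else 0) - r j k * (x j)\<^sup>2 / 2 - r j k * (x k)\<^sup>2 / 2)"
    using swap by (simp add: sum_subtractf sum.delta)
  also have "\<dots> \<le> (\<Sum>j<m. \<Sum>k<m. q j k * x j * x k)"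
    by (intro sum_mono le)
  finally show ?thesis .
qed

text \<open>With truncated subtraction the argument of \<open>t\<close> is the distance of
  \<open>j\<close> and \<open>k\<close>.\<close>

definition toeplitz_entry :: "(nat \<Rightarrow> real) \<Rightarrow> nat \<Rightarrow> nat \<Rightarrow> real" where
  "toeplitz_entry t j k = t ((j - k) + (k - j))"

text \<open>
  The Hankel matrix in \<open>tau_mat\<close> at 0-based position \<open>(j, k)\<close>, where \<open>t i\<close> is the paper's \<open>t\<^sub>i\<^sub>+\<^sub>1\<close>.
\<close>

definition hankel_entry :: "(nat \<Rightarrow> real) \<Rightarrow> nat \<Rightarrow> nat \<Rightarrow> nat \<Rightarrow> real" where
  "hankel_entry t m j k =
    (if j + k + 2 < m then t (j + k + 2) else 0) + (if m < j + k then t (2 * m - (j + k)) else 0)"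

text \<open>
  The entries in a row of the Hankel matrix are coefficients that the same row of the Toeplitz
  matrix cuts off, so they fit into the gap left in the sum hypothesis.
\<close>

lemma row_sum_toeplitz_hankel:
  fixes t :: "nat \<Rightarrow> real"
  assumes neg: "\<And>i. 1 \<le> i \<Longrightarrow> t i \<le> 0"
    and sum: "\<And>n. 0 \<le> t 0 / 2 + (\<Sum>i = 1..n. t i)"
    and j: "j < m"
  shows "0 \<le> (\<Sum>k<m. toeplitz_entry t j k) + (\<Sum>k<m. hankel_entry t m j k)"
proof -
  have T: "(\<Sum>k<m. toeplitz_entry t j k) = t 0 + (\<Sum>i = 1..j. t i) + (\<Sum>i = 1..m - 1 - j. t i)"
  proof -
    have split: "{..<m} = {..<j} \<union> ({j} \<union> {j<..<m})" using j by auto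
    have "(\<Sum>k<m. toeplitz_entry t j k) = (\<Sum>k<j. toeplitz_entry t j k)
        + (toeplitz_entry t j j + (\<Sum>k\<in>{j<..<m}. toeplitz_entry t j k))"
      unfolding split by (subst sum.union_disjoint) auto
    also have "(\<Sum>k<j. toeplitz_entry t j k) = (\<Sum>i = 1..j. t i)"
      by (rule sum.reindex_bij_witness[of _ "\<lambda>i. j - i" "\<lambda>k. j - k"]) (auto simp: toeplitz_entry_def)
    also have "(\<Sum>k\<in>{j<..<m}. toeplitz_entry t j k) = (\<Sum>i = 1..m - 1 - j. t i)"
      by (rule sum.reindex_bij_witness[of _ "\<lambda>i. j + i" "\<lambda>k. k - j"]) (auto simp: toeplitz_entry_def)
    finally show ?thesis by (simp add: toeplitz_entry_def)
  qed
  have "(\<Sum>k<m. if j + k + 2 < m then t (j + k + 2) else 0) = (\<Sum>k\<in>{k\<in>{..<m}. j + k + 2 < m}. t (j + k + 2))"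
    by (rule sum.inter_filter[symmetric]) simp
  also have "\<dots> = (\<Sum>i = j + 2..<m. t i)"
    by (rule sum.reindex_bij_witness[of _ "\<lambda>i. i - (j + 2)" "\<lambda>k. j + k + 2"]) auto
  finally have H1: "(\<Sum>k<m. if j + k + 2 < m then t (j + k + 2) else 0) = (\<Sum>i = j + 2..<m. t i)" .
  have "(\<Sum>k<m. if m < j + k then t (2 * m - (j + k)) else 0) = (\<Sum>k\<in>{k\<in>{..<m}. m < j + k}. t (2 * m - (j + k)))"
    by (rule sum.inter_filter[symmetric]) simp
  also have "\<dots> = (\<Sum>i = m - j + 1..<m. t i)"
    using j by (intro sum.reindex_bij_witness[of _ "\<lambda>i. 2 * m - (j + i)" "\<lambda>k. 2 * m - (j + k)"]) auto
  finally have H2: "(\<Sum>k<m. if m < j + k then t (2 * m - (j + k)) else 0) = (\<Sum>i = m - j + 1..<m. t i)" .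
  \<comment> \<open>All terms are nonpositive, so summing over fewer indices can only increase the
    sum.\<close>
  have gap: "(\<Sum>i = 1..m - 1. t i) \<le> sum t A + sum t B"
    if "A \<inter> B = {}" "A \<union> B \<subseteq> {1..m - 1}" for A B
  proof -
    have fin: "finite A" "finite B" using that by (auto intro: finite_subset)
    have "sum (\<lambda>i. - t i) (A \<union> B) \<le> (\<Sum>i = 1..m - 1. - t i)"
      using that neg by (intro sum_mono2) auto
    then show ?thesis
      using that fin by (simp add: sum.union_disjoint sum_negf)
  qed
  \<comment> \<open>Each side of the diagonal is paired with one corner of the Hankel matrix. Each
    pair fits into \<open>{1..m - 1}\<close>, so the sum hypothesis is used twice, which accounts
    for the full \<open>t 0\<close>.\<close>
  have "(\<Sum>i = 1..m - 1. t i) \<le> (\<Sum>i = 1..j. t i) + (\<Sum>i = j + 2..<m. t i)"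
    using j by (intro gap) auto
  moreover have "(\<Sum>i = 1..m - 1. t i) \<le> (\<Sum>i = 1..m - 1 - j. t i) + (\<Sum>i = m - j + 1..<m. t i)"
    using j by (intro gap) auto
  ultimately show ?thesis
    using sum[of "m - 1"] unfolding hankel_entry_def sum.distrib T H1 H2 by linarith
qed

text \<open>For both signs \<open>s\<close> the matrix of \<open>T - H - 2 * s * H\<close> is
  diagonally dominant. Off the diagonal the Toeplitz entry is at most the Hankel entry, which is at
  most 0, so the absolute value is at most minus the sum of the two; the row sums then give
  dominance.\<close>

lemma hankel_form_le_tau_form:
  fixes t x :: "nat \<Rightarrow> real" and m :: nat
  assumes neg: "\<And>i. 1 \<le> i \<Longrightarrow> t i \<le> 0"
    and mono: "\<And>i. 1 \<le> i \<Longrightarrow> t i \<le> t (Suc i)"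
    and sum: "\<And>n. 0 \<le> t 0 / 2 + (\<Sum>i = 1..n. t i)"
  defines "T \<equiv> \<Sum>j<m. \<Sum>k<m. toeplitz_entry t j k * x j * x k"
    and "H \<equiv> \<Sum>j<m. \<Sum>k<m. hankel_entry t m j k * x j * x k"
  shows "2 * \<bar>H\<bar> \<le> T - H"
proof -
  have mono': "t i \<le> t j" if "1 \<le> i" "i \<le> j" for i j
    using that(2)
  proof (induction rule: dec_induct)
    case (step n)
    then show ?case using mono[of n] that(1) by linarith
  qed simp
  have le0: "hankel_entry t m j k \<le> 0" if "j < m" "k < m" for j k
    using that by (auto simp: hankel_entry_def intro!: neg)
  \<comment> \<open>The Hankel index exceeds the distance of \<open>j\<close> and \<open>k\<close>,
    and \<open>t\<close> increases from index 1 on; where the Hankel entry is 0, the sign of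
    \<open>t\<close> suffices.\<close>
  have ge: "toeplitz_entry t j k \<le> hankel_entry t m j k" if "j < m" "k < m" "k \<noteq> j" for j k
    using that neg[of "(j - k) + (k - j)"]
    by (auto simp: hankel_entry_def toeplitz_entry_def intro!: mono')
  have key: "0 \<le> T - H - 2 * s * H" if s: "s = 1 \<or> s = - 1" for s
  proof -
    let ?T = "toeplitz_entry t" and ?H = "hankel_entry t m"
    have "0 \<le> (\<Sum>j<m. \<Sum>k<m. (?T j k - ?H j k - 2 * s * ?H j k) * x j * x k)"
    proof (rule diagonally_dominant_form_nonneg)
      show "?T j k - ?H j k - 2 * s * ?H j k = ?T k j - ?H k j - 2 * s * ?H k j" for j k
        by (simp add: toeplitz_entry_def hankel_entry_def add.commute)
    next
      fix j assume j: "j < m"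
      have "(\<Sum>k<m. if k = j then 0 else \<bar>?T j k - ?H j k - 2 * s * ?H j k\<bar>)
          \<le> (\<Sum>k<m. (if k = j then t 0 + ?H j j else 0) - ?T j k - ?H j k)"
      proof (rule sum_mono)
        fix k assume "k \<in> {..<m}"
        then show "(if k = j then 0 else \<bar>?T j k - ?H j k - 2 * s * ?H j k\<bar>)
            \<le> (if k = j then t 0 + ?H j j else 0) - ?T j k - ?H j k"
          using ge[OF j, of k] le0[OF j, of k] s by (cases "k = j") (auto simp: toeplitz_entry_def)
      qed
      also have "\<dots> = t 0 + ?H j j - ((\<Sum>k<m. ?T j k) + (\<Sum>k<m. ?H j k))"
        using j by (simp add: sum_subtractf sum.delta)
      also have "\<dots> \<le> t 0 + ?H j j"
        using row_sum_toeplitz_hankel[OF neg sum j] by simp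
      also have "\<dots> \<le> ?T j j - ?H j j - 2 * s * ?H j j"
        using le0[OF j j] s by (auto simp: toeplitz_entry_def)
      finally show "(\<Sum>k<m. if k = j then 0 else \<bar>?T j k - ?H j k - 2 * s * ?H j k\<bar>)
        \<le> ?T j j - ?H j j - 2 * s * ?H j j" .
    qed
    also have "\<dots> = T - H - 2 * s * H"
      unfolding T_def H_def by (simp add: left_diff_distrib sum_subtractf sum_distrib_left mult.assoc)
    finally show ?thesis .
  qed
  show ?thesis
    using key[of 1] key[of "- 1"] by auto
qed

text \<open>The first column of the symmetric part. Above the diagonal \<open>L_mat\<close> has only
  the entry \<open>- w_coeff a 0\<close> at distance 1, hence the mixed term there; farther away one
  of the two averaged entries is 0.\<close>

definition sym_L_coeff :: "real \<Rightarrow> nat \<Rightarrow> real" where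
  "sym_L_coeff a i = (if i = 0 then - w_coeff a 1
     else if i = 1 then - (w_coeff a 0 + w_coeff a 2) / 2 else - w_coeff a (i + 1) / 2)"

lemma sym_part_L_mat_index:
  assumes "j < m" "k < m"
  shows "sym_part (L_mat a m) $$ (j, k) = toeplitz_entry (sym_L_coeff a) j k"
proof -
  have s: "sym_part (L_mat a m) $$ (j, k) = (L_mat a m $$ (j, k) + L_mat a m $$ (k, j)) / 2"
    using assms by (simp add: sym_part_def L_mat_def)
  \<comment> \<open>Writing the distance as \<open>Suc (Suc i)\<close> in the remaining cases lets
    simplification evaluate the truncated subtractions.\<close>
  have "j = k \<or> j = k + 1 \<or> k = j + 1 \<or> j = k + Suc (Suc (j - k - 2)) \<or> k = j + Suc (Suc (k - j - 2))"
    by arith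
  then consider "j = k" | "j = k + 1" | "k = j + 1" | i where "j = k + Suc (Suc i)" | i where "k = j + Suc (Suc i)"
    by blast
  then show ?thesis
    unfolding s using assms
    by cases (simp_all add: L_mat_def toeplitz_entry_def sym_L_coeff_def eval_nat_numeral del: w_coeff.simps)
qed

text \<open>The zeros padding the two defining vectors cover the antidiagonals \<open>j + k\<close>
  from \<open>m - 2\<close> to \<open>m\<close>, exactly those on which both cases of
  \<open>hankel_entry\<close> fail.\<close>

lemma tau_mat_index:
  assumes m: "dim_row T = m" "dim_col T = m"
    and T: "\<And>j k. j < m \<Longrightarrow> k < m \<Longrightarrow> T $$ (j, k) = toeplitz_entry t j k"
    and "j < m" "k < m"
  shows "tau_mat T $$ (j, k) = toeplitz_entry t j k - hankel_entry t m j k"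
proof -
  have "0 < m" using assms by simp
  with assms show ?thesis
    by (auto simp: tau_mat_def Let_def hankel_mat_def hankel_entry_def toeplitz_entry_def intro!: arg_cong[where f = t])
qed

lemma dim_tau_mat [simp]: "dim_row (tau_mat T) = dim_row T" "dim_col (tau_mat T) = dim_row T"
  by (simp_all add: tau_mat_def Let_def hankel_mat_def)

lemma dim_sym_part [simp]: "dim_row (sym_part Z) = dim_col Z" "dim_col (sym_part Z) = dim_row Z"
  by (simp_all add: sym_part_def)

lemma dim_L_mat [simp]: "dim_row (L_mat a m) = m" "dim_col (L_mat a m) = m"
  by (simp_all add: L_mat_def)

lemma tau_sym_L_mat_index:
  assumes "j < m" "k < m"
  shows "tau_mat (sym_part (L_mat a m)) $$ (j, k)
    = toeplitz_entry (sym_L_coeff a) j k - hankel_entry (sym_L_coeff a) m j k"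
  using assms by (intro tau_mat_index sym_part_L_mat_index) auto

text \<open>A quadratic form sees only the symmetric part, so \<open>B = T\<close>, while
  \<open>C = T - H\<close>. Thus \<open>B - C\<close> is the Hankel form, which is at most
  \<open>C / 2\<close> in absolute value.\<close>

lemma tau_L_mat_form_bounds:
  fixes x :: "nat \<Rightarrow> real" and m :: nat
  assumes a: "1 < a" "a < 2"
  defines "B \<equiv> mat_form (L_mat a m) x x" and "C \<equiv> mat_form (tau_mat (sym_part (L_mat a m))) x x"
  shows "C / 2 \<le> B" "B \<le> 3 / 2 * C"
proof -
  let ?t = "sym_L_coeff a"
  define T where "T = (\<Sum>j<m. \<Sum>k<m. toeplitz_entry ?t j k * x j * x k)"
  define H where "H = (\<Sum>j<m. \<Sum>k<m. hankel_entry ?t m j k * x j * x k)"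
  have C: "C = T - H"
    unfolding C_def T_def H_def mat_form_def
    by (simp add: tau_sym_L_mat_index left_diff_distrib sum_subtractf)
  have "T = (\<Sum>j<m. \<Sum>k<m. (L_mat a m $$ (j, k) * x j * x k + L_mat a m $$ (k, j) * x k * x j) / 2)"
    unfolding T_def
    by (intro sum.cong refl)
       (simp add: sym_part_L_mat_index[symmetric] sym_part_def algebra_simps add_divide_distrib)
  also have "\<dots> = B"
    unfolding B_def mat_form_def add_divide_distrib sum.distrib
    by (subst (2) sum.swap) (simp add: sum_divide_distrib[symmetric])
  finally have B: "B = T" by simp
  have "2 * \<bar>H\<bar> \<le> T - H"
    unfolding T_def H_def
  proof (rule hankel_form_le_tau_form)
    \<comment> \<open>The coefficient at index 1 involves \<open>w_coeff a 0\<close> and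
      \<open>w_coeff a 2\<close>, below the range of the sign and monotonicity lemmas. The closed
      forms share the nonnegative factor \<open>a * (a - 1)\<close>.\<close>
    have w: "w_coeff a 0 + w_coeff a 2 = a * (a - 1) * (a + 2) / 4"
      by (simp add: numeral_2_eq_2 algebra_simps add_divide_distrib diff_divide_distrib)
    have w3: "w_coeff a 3 = a * (a - 1) * (2 - a) * (a + 3) / 12"
      by (simp add: numeral_3_eq_3 field_simps)
    have a0: "0 \<le> a * (a - 1)" using a by simp
    show "?t i \<le> 0" if "1 \<le> i" for i
      using that w_coeff_nonneg[OF a, of "i + 1"] mult_nonneg_nonneg[OF a0, of "a + 2"] a
      by (auto simp: sym_L_coeff_def w simp del: w_coeff.simps)
    show "?t i \<le> ?t (Suc i)" if "1 \<le> i" for i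
    proof (cases "i = 1")
      case True
      have "a * (a - 1) * ((2 - a) * (a + 3) / 3) \<le> a * (a - 1) * (a + 2)"
        using a0 a by (intro mult_left_mono) (auto simp: algebra_simps)
      then show ?thesis
        using True by (simp add: sym_L_coeff_def w[unfolded numeral_2_eq_2] w3[unfolded numeral_3_eq_3]
          numeral_2_eq_2 numeral_3_eq_3 del: w_coeff.simps)
    next
      case False
      then show ?thesis
        using that w_coeff_Suc_le[OF a, of "i + 1"] by (simp add: sym_L_coeff_def del: w_coeff.simps)
    qed
    \<comment> \<open>Half the diagonal plus the off-diagonal coefficients is minus half a partial
      sum of \<open>w_coeff\<close>, whose sign is known.\<close>
    have part: "?t 0 / 2 + (\<Sum>i = 1..Suc n. ?t i) = - (\<Sum>k\<le>n + 2. w_coeff a k) / 2" for n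
      by (induction n) (simp_all add: sym_L_coeff_def eval_nat_numeral add_divide_distrib
        diff_divide_distrib del: w_coeff.simps)
    show "0 \<le> ?t 0 / 2 + (\<Sum>i = 1..n. ?t i)" for n
    proof (cases n)
      case 0
      have "w_coeff a 1 = (1 - a) * (a + 2) / 2"
        by (simp add: field_simps)
      then show ?thesis
        using 0 a mult_nonpos_nonneg[of "1 - a" "a + 2"] by (simp add: sym_L_coeff_def del: w_coeff.simps)
    next
      case (Suc k)
      then show ?thesis
        using w_coeff_partial_sum_nonpos[OF a, of "k + 2"] by (simp only: part) simp
    qed
  qed
  then have le: "3 * H \<le> T" "- H \<le> T"
    by (auto simp: abs_if split: if_splits)
  show "C / 2 \<le> B"
    using le by (simp add: B C field_simps)
  show "B \<le> 3 / 2 * C"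
    using le by (simp add: B C field_simps)
qed


subsection \<open>Kronecker products and levels\<close>

lemma mat_form_cong:
  assumes "\<And>j. j < dim_row A \<Longrightarrow> x j = x' j" "\<And>k. k < dim_col A \<Longrightarrow> y k = y' k"
  shows "mat_form A x y = mat_form A x' y'"
  using assms by (simp add: mat_form_def)

lemma mat_form_add_mat:
  assumes "A \<in> carrier_mat r c" "B \<in> carrier_mat r c"
  shows "mat_form (A + B) x y = mat_form A x y + mat_form B x y"
  using assms by (simp add: mat_form_def sum.distrib ring_distribs)

lemma mat_form_smult_mat: "mat_form (c \<cdot>\<^sub>m A) x y = c * mat_form A x y"
  by (simp add: mat_form_def sum_distrib_left mult.assoc)

lemma mat_form_one: "mat_form (1\<^sub>m N) x y = (\<Sum>j<N. x j * y j)"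
proof -
  have "mat_form (1\<^sub>m N) x y = (\<Sum>j<dim_row (1\<^sub>m N :: real mat).
      \<Sum>k<dim_col (1\<^sub>m N :: real mat). if j = k then x j * y k else 0)"
    unfolding mat_form_def by (intro sum.cong refl) simp_all
  then show ?thesis by simp
qed

lemma mat_form_transpose: "mat_form (transpose_mat A) x y = mat_form A y x"
  unfolding mat_form_def by (subst sum.swap) (simp add: mult_ac)

text \<open>The form is evaluated at the sum and at the difference of \<open>x\<close> and
  \<open>y\<close>. \<open>A\<close> may be nonsymmetric, so both mixed terms appear.\<close>

lemma mat_form_psd_polarization:
  assumes "\<And>x. 0 \<le> mat_form A x x" and A: "A \<in> carrier_mat m m"
  shows "\<bar>mat_form A x y + mat_form A y x\<bar> \<le> mat_form A x x + mat_form A y y"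
proof -
  have "mat_form A (\<lambda>j. x j + y j) (\<lambda>j. x j + y j)
      = mat_form A x x + mat_form A y y + (mat_form A x y + mat_form A y x)"
    by (simp add: mat_form_def algebra_simps sum.distrib)
  moreover have "mat_form A (\<lambda>j. x j - y j) (\<lambda>j. x j - y j)
      = mat_form A x x + mat_form A y y - (mat_form A x y + mat_form A y x)"
    by (simp add: mat_form_def algebra_simps sum.distrib sum_subtractf)
  ultimately show ?thesis
    using assms(1)[of "\<lambda>j. x j + y j"] assms(1)[of "\<lambda>j. x j - y j"] by linarith
qed

lemma scalar_prod_mult_mat_vec:
  assumes "A \<in> carrier_mat N N" "x \<in> carrier_vec N" "y \<in> carrier_vec N"
  shows "x \<bullet> (A *\<^sub>v y) = mat_form A (vec_index x) (vec_index y)"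
  using assms
  by (simp add: scalar_prod_def mat_form_def atLeast0LessThan sum_distrib_left mult_ac)

section \<open>Kronecker products and slices along one level\<close>

lemma dim_kronecker [simp]:
  "dim_row (A \<otimes>\<^sub>K B) = dim_row A * dim_row B" "dim_col (A \<otimes>\<^sub>K B) = dim_col A * dim_col B"
  by (simp_all add: kronecker_def)

lemma div_mod_less_mult:
  fixes j a b :: nat
  assumes "j < a * b"
  shows "j div b < a" "j mod b < b"
proof -
  have "0 < b" using assms by (cases b) auto
  then show "j div b < a" "j mod b < b"
    using assms by (auto simp: less_mult_imp_div_less)
qed

lemma sum_lessThan_mult:
  fixes f :: "nat \<Rightarrow> 'a :: comm_monoid_add"
  shows "(\<Sum>i<a * b. f i) = (\<Sum>i<a. \<Sum>j<b. f (i * b + j))"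
proof -
  have "(\<Sum>k = i * b..<i * b + b. f k) = (\<Sum>j<b. f (i * b + j))" for i
    by (rule sum.reindex_bij_witness[of _ "\<lambda>j. i * b + j" "\<lambda>k. k - i * b"]) auto
  then show ?thesis
    by (simp add: sum.nat_group[symmetric])
qed

lemma kronecker_index:
  assumes "i < dim_row A" "i' < dim_row B" "j < dim_col A" "j' < dim_col B"
  shows "(A \<otimes>\<^sub>K B) $$ (i * dim_row B + i', j * dim_col B + j') = A $$ (i, j) * B $$ (i', j')"
proof -
  have less: "i * b + i' < a * b" if "i < a" "i' < b" for i i' a b :: nat
    using mult_le_mono1[of "Suc i" a b] that by simp
  have "i * dim_row B + i' < dim_row A * dim_row B" "j * dim_col B + j' < dim_col A * dim_col B"
    using assms by (auto intro: less)
  then show ?thesis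
    using assms by (simp add: kronecker_def)
qed

lemma mat_form_one_kronecker:
  "mat_form (1\<^sub>m p \<otimes>\<^sub>K X) x y
    = (\<Sum>s<p. mat_form X (\<lambda>j. x (s * dim_row X + j)) (\<lambda>k. y (s * dim_col X + k)))"
proof -
  have "mat_form (1\<^sub>m p \<otimes>\<^sub>K X) x y = (\<Sum>s<p. \<Sum>j<dim_row X. \<Sum>s'<p. \<Sum>k<dim_col X.
      (1\<^sub>m p \<otimes>\<^sub>K X) $$ (s * dim_row X + j, s' * dim_col X + k) * x (s * dim_row X + j) * y (s' * dim_col X + k))"
    by (simp add: mat_form_def sum_lessThan_mult)
  also have "\<dots> = (\<Sum>s<p. \<Sum>j<dim_row X. \<Sum>s'<p. \<Sum>k<dim_col X.
      (if s = s' then X $$ (j, k) * x (s * dim_row X + j) * y (s' * dim_col X + k) else 0))"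
    by (intro sum.cong refl) (simp add: kronecker_index)
  also have "\<dots> = (\<Sum>s<p. \<Sum>j<dim_row X. \<Sum>s'<p. if s = s' then
      (\<Sum>k<dim_col X. X $$ (j, k) * x (s * dim_row X + j) * y (s' * dim_col X + k)) else 0)"
    by (intro sum.cong refl) simp
  finally show ?thesis
    by (simp add: mat_form_def)
qed

lemma mat_form_kronecker_one:
  "mat_form (X \<otimes>\<^sub>K 1\<^sub>m q) x y = (\<Sum>t<q. mat_form X (\<lambda>j. x (j * q + t)) (\<lambda>k. y (k * q + t)))"
proof -
  have *: "(X \<otimes>\<^sub>K 1\<^sub>m q) $$ (j * q + t, k * q + t') = X $$ (j, k) * 1\<^sub>m q $$ (t, t')"
    if "j < dim_row X" "k < dim_col X" "t < q" "t' < q" for j k t t'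
    using kronecker_index[of j X t "1\<^sub>m q" k t'] that by simp
  have "mat_form (X \<otimes>\<^sub>K 1\<^sub>m q) x y = (\<Sum>j<dim_row X. \<Sum>t<q. \<Sum>k<dim_col X. \<Sum>t'<q.
      (X \<otimes>\<^sub>K 1\<^sub>m q) $$ (j * q + t, k * q + t') * x (j * q + t) * y (k * q + t'))"
    by (simp add: mat_form_def sum_lessThan_mult)
  also have "\<dots> = (\<Sum>j<dim_row X. \<Sum>t<q. \<Sum>k<dim_col X. \<Sum>t'<q.
      (if t = t' then X $$ (j, k) * x (j * q + t) * y (k * q + t') else 0))"
    by (intro sum.cong refl) (simp add: *)
  also have "\<dots> = (\<Sum>j<dim_row X. \<Sum>t<q. \<Sum>k<dim_col X. X $$ (j, k) * x (j * q + t) * y (k * q + t))"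
    by simp
  also have "\<dots> = (\<Sum>t<q. mat_form X (\<lambda>j. x (j * q + t)) (\<lambda>k. y (k * q + t)))"
    unfolding mat_form_def by (rule sum.swap)
  finally show ?thesis .
qed

text \<open>The slices run over all indices of the other levels. One-level inequalities between
  forms thus pass to \<open>at_level\<close> by summation.\<close>

lemma mat_form_at_level:
  fixes X :: "real mat" and n :: "nat \<Rightarrow> nat" and d i :: nat
  assumes "X \<in> carrier_mat m m"
  defines "p \<equiv> \<Prod>j = 1..<i. n j" and "q \<equiv> \<Prod>j = i + 1..d. n j"
  shows "mat_form (at_level d n i X) x y
    = (\<Sum>t<q. \<Sum>s<p. mat_form X (\<lambda>j. x ((s * m + j) * q + t)) (\<lambda>k. y ((s * m + k) * q + t)))"
  using assms by (simp add: at_level_def mat_form_kronecker_one mat_form_one_kronecker)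

lemma at_level_carrier:
  assumes "X \<in> carrier_mat (n i) (n i)" "i \<in> {1..d}"
  shows "at_level d n i X \<in> carrier_mat (\<Prod>j = 1..d. n j) (\<Prod>j = 1..d. n j)"
proof -
  have "{1..d} = {1..<i} \<union> ({i} \<union> {i + 1..d})" using assms(2) by auto
  then have "(\<Prod>j = 1..d. n j) = prod n ({1..<i} \<union> ({i} \<union> {i + 1..d}))" by simp
  also have "\<dots> = (\<Prod>j = 1..<i. n j) * (n i * (\<Prod>j = i + 1..d. n j))"
    by (subst prod.union_disjoint) auto
  finally have "(\<Prod>j = 1..d. n j) = (\<Prod>j = 1..<i. n j) * (n i * (\<Prod>j = i + 1..d. n j))" .
  then show ?thesis
    using assms(1) by (intro carrier_matI) (simp_all add: at_level_def)
qed

lemma mat_form_level_sum: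
  assumes "\<And>i. i \<in> {1..d} \<Longrightarrow> F i \<in> carrier_mat N N"
  shows "level_sum N d F \<in> carrier_mat N N"
    and "mat_form (level_sum N d F) x y = (\<Sum>i = 1..d. mat_form (F i) x y)"
proof -
  have *: "foldr (\<lambda>i S. F i + S) xs (0\<^sub>m N N) \<in> carrier_mat N N \<and>
      mat_form (foldr (\<lambda>i S. F i + S) xs (0\<^sub>m N N)) x y = (\<Sum>i\<leftarrow>xs. mat_form (F i) x y)"
    if "set xs \<subseteq> {1..d}" for xs
    using that
  proof (induction xs)
    case Nil
    then show ?case by (simp add: mat_form_def)
  next
    case (Cons i xs)
    then show ?case
      using assms[of i] by (auto simp: mat_form_add_mat[of _ N N])
  qed
  have "{1..d} = set [1..<d + 1]" by auto
  then have "(\<Sum>i = 1..d. mat_form (F i) x y) = (\<Sum>i\<leftarrow>[1..<d + 1]. mat_form (F i) x y)"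
    by (simp only: sum.distinct_set_conv_list[OF distinct_upt])
  then show "level_sum N d F \<in> carrier_mat N N"
    "mat_form (level_sum N d F) x y = (\<Sum>i = 1..d. mat_form (F i) x y)"
    using *[of "[1..<d + 1]"] by (simp_all add: level_sum_def ivl_subset atLeastLessThanSuc_atLeastAtMost del: upt_Suc)
qed

section \<open>Index reversal, which for square matrices is conjugation by the anti-identity\<close>

definition flip_mat :: "real mat \<Rightarrow> real mat" where
  "flip_mat X = mat (dim_row X) (dim_col X) (\<lambda>(j, k). X $$ (dim_row X - Suc j, dim_col X - Suc k))"

lemma dim_flip_mat [simp]: "dim_row (flip_mat X) = dim_row X" "dim_col (flip_mat X) = dim_col X"
  by (simp_all add: flip_mat_def)

lemma mat_form_flip_mat:
  assumes "X \<in> carrier_mat N N"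
  shows "mat_form (flip_mat X) x y = mat_form X (\<lambda>j. x (N - Suc j)) (\<lambda>j. y (N - Suc j))"
proof -
  have "mat_form (flip_mat X) x y = (\<Sum>j<N. \<Sum>k<N. X $$ (N - Suc j, N - Suc k) * x j * y k)"
    using assms by (simp add: mat_form_def flip_mat_def)
  also have "\<dots> = (\<Sum>j<N. \<Sum>k<N. X $$ (N - Suc j, k) * x j * y (N - Suc k))"
    by (rule sum.cong[OF refl], subst sum.nat_diff_reindex[symmetric]) (auto intro!: sum.cong)
  also have "\<dots> = (\<Sum>j<N. \<Sum>k<N. X $$ (j, k) * x (N - Suc j) * y (N - Suc k))"
    by (subst sum.nat_diff_reindex[symmetric]) (auto intro!: sum.cong)
  finally show ?thesis
    using assms by (simp add: mat_form_def)
qed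

text \<open>\<open>a * b - 1\<close> has the largest possible quotient and remainder, so subtracting
  \<open>j\<close> needs no borrow and reverses both digits separately.\<close>

lemma div_mod_reverse:
  fixes j a b :: nat
  assumes "j < a * b"
  shows "(a * b - Suc j) div b = a - Suc (j div b)" "(a * b - Suc j) mod b = b - Suc (j mod b)"
proof -
  note dm = div_mod_less_mult[OF assms]
  obtain k where k: "a = Suc (j div b + k)"
    using less_imp_Suc_add[OF dm(1)] by auto
  have "a * b - Suc j = k * b + (b - Suc (j mod b))"
  proof -
    have "a * b = k * b + b + b * (j div b)"
      unfolding k by (simp add: algebra_simps)
    moreover have "j = b * (j div b) + j mod b" by simp
    ultimately show ?thesis using dm(2) by linarith
  qed
  moreover have "b - Suc (j mod b) < b" using dm(2) by simp
  ultimately show "(a * b - Suc j) div b = a - Suc (j div b)" "(a * b - Suc j) mod b = b - Suc (j mod b)"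
    using k by simp_all
qed

lemma flip_mat_kronecker: "flip_mat (A \<otimes>\<^sub>K B) = flip_mat A \<otimes>\<^sub>K flip_mat B"
proof (rule eq_matI)
  fix j k assume "j < dim_row (flip_mat A \<otimes>\<^sub>K flip_mat B)" "k < dim_col (flip_mat A \<otimes>\<^sub>K flip_mat B)"
  then have jk: "j < dim_row A * dim_row B" "k < dim_col A * dim_col B" by simp_all
  then show "flip_mat (A \<otimes>\<^sub>K B) $$ (j, k) = (flip_mat A \<otimes>\<^sub>K flip_mat B) $$ (j, k)"
    using div_mod_less_mult[OF jk(1)] div_mod_less_mult[OF jk(2)]
    by (simp add: flip_mat_def kronecker_def div_mod_reverse)
qed simp_all

lemma transpose_kronecker: "transpose_mat (A \<otimes>\<^sub>K B) = transpose_mat A \<otimes>\<^sub>K transpose_mat B"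
  by (rule eq_matI) (auto simp: kronecker_def div_mod_less_mult)

lemma flip_mat_one: "flip_mat (1\<^sub>m N) = 1\<^sub>m N"
  by (rule eq_matI) (auto simp: flip_mat_def)

lemma flip_mat_at_level: "flip_mat (at_level d n i X) = at_level d n i (flip_mat X)"
  by (simp add: at_level_def flip_mat_kronecker flip_mat_one)

lemma transpose_at_level: "transpose_mat (at_level d n i X) = at_level d n i (transpose_mat X)"
  by (simp add: at_level_def transpose_kronecker)

text \<open>Reversal negates the offset \<open>j - k\<close> of a Toeplitz entry. This makes the
  anti-identity times \<open>A\<close> symmetric.\<close>

lemma flip_L_mat: "flip_mat (L_mat a m) = transpose_mat (L_mat a m)"
  by (rule eq_matI) (auto simp: flip_mat_def L_mat_def intro!: arg_cong[where f = "w_coeff a"])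

text \<open>Reversal preserves distances and exchanges the two corners of the Hankel matrix, which
  carry the same coefficients.\<close>

lemma toeplitz_hankel_entry_flip:
  assumes "j < m" "k < m"
  shows "toeplitz_entry t (m - Suc j) (m - Suc k) = toeplitz_entry t j k"
    and "hankel_entry t m (m - Suc j) (m - Suc k) = hankel_entry t m j k"
proof -
  show "toeplitz_entry t (m - Suc j) (m - Suc k) = toeplitz_entry t j k"
    using assms by (auto simp: toeplitz_entry_def intro!: arg_cong[where f = t])
  have *: "(m - Suc j) + (m - Suc k) + 2 = 2 * m - (j + k)"
    "2 * m - ((m - Suc j) + (m - Suc k)) = j + k + 2"
    "m < (m - Suc j) + (m - Suc k) \<longleftrightarrow> j + k + 2 < m"
    "2 * m - (j + k) < m \<longleftrightarrow> m < j + k"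
    using assms by linarith+
  show "hankel_entry t m (m - Suc j) (m - Suc k) = hankel_entry t m j k"
    unfolding hankel_entry_def * by simp
qed

lemma flip_tau_L_mat: "flip_mat (tau_mat (sym_part (L_mat a m))) = tau_mat (sym_part (L_mat a m))"
  by (rule eq_matI) (simp_all add: flip_mat_def tau_sym_L_mat_index toeplitz_hankel_entry_flip)

lemma transpose_tau_L_mat:
  "transpose_mat (tau_mat (sym_part (L_mat a m))) = tau_mat (sym_part (L_mat a m))"
  by (rule eq_matI) (auto simp: tau_sym_L_mat_index toeplitz_entry_def hankel_entry_def add.commute)

lemma anti_id_carrier [simp]: "anti_id N \<in> carrier_mat N N"
  by (simp add: anti_id_def)

lemma anti_id_kronecker: "anti_id a \<otimes>\<^sub>K anti_id b = anti_id (a * b)"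
proof (rule eq_matI)
  fix j k assume "j < dim_row (anti_id (a * b))" "k < dim_col (anti_id (a * b))"
  then have jk: "j < a * b" "k < a * b" by (simp_all add: anti_id_def)
  note dm = div_mod_less_mult[OF jk(1)] div_mod_less_mult[OF jk(2)]
  have "j + k + 1 = a * b \<longleftrightarrow> k = a * b - Suc j" using jk by auto
  also have "\<dots> \<longleftrightarrow> k div b = (a * b - Suc j) div b \<and> k mod b = (a * b - Suc j) mod b"
    by (metis div_mult_mod_eq)
  also have "\<dots> \<longleftrightarrow> j div b + k div b + 1 = a \<and> j mod b + k mod b + 1 = b"
    unfolding div_mod_reverse[OF jk(1)] using dm by linarith
  finally show "(anti_id a \<otimes>\<^sub>K anti_id b) $$ (j, k) = anti_id (a * b) $$ (j, k)"
    using jk dm by (simp add: kronecker_def anti_id_def)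
qed (simp_all add: anti_id_def)

lemma multi_anti_id_eq: "multi_anti_id d n = anti_id (\<Prod>i = 1..d. n i)"
proof -
  have "foldr (\<lambda>i Y. anti_id (n i) \<otimes>\<^sub>K Y) xs (1\<^sub>m 1) = anti_id (prod_list (map n xs))" for xs
  proof (induction xs)
    case Nil
    show ?case by (rule eq_matI) (auto simp: anti_id_def)
  qed (simp add: anti_id_kronecker)
  moreover have "{1..d} = set [1..<d + 1]" by auto
  then have "(\<Prod>i = 1..d. n i) = prod_list (map n [1..<d + 1])"
    by (simp only: prod.distinct_set_conv_list[OF distinct_upt])
  ultimately show ?thesis
    by (simp add: multi_anti_id_def del: upt_Suc)
qed

lemma scalar_prod_anti_id:
  assumes "u \<in> carrier_vec N" "v \<in> carrier_vec N"
  shows "u \<bullet> (anti_id N *\<^sub>v v) = (\<Sum>j<N. u $ (N - Suc j) * v $ j)"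
proof -
  have *: "j + k + 1 = N \<longleftrightarrow> j = N - Suc k" if "k < N" for j k
    using that by auto
  have "u \<bullet> (anti_id N *\<^sub>v v) = (\<Sum>j<N. \<Sum>k<N. (if j + k + 1 = N then u $ j * v $ k else 0))"
    unfolding scalar_prod_mult_mat_vec[OF anti_id_carrier assms]
    by (auto simp: mat_form_def anti_id_def intro!: sum.cong)
  also have "\<dots> = (\<Sum>k<N. \<Sum>j<N. (if j = N - Suc k then u $ j * v $ k else 0))"
    by (subst sum.swap) (auto simp: * intro!: sum.cong)
  also have "\<dots> = (\<Sum>j<N. u $ (N - Suc j) * v $ j)"
    by (auto simp: sum.delta intro!: sum.cong)
  finally show ?thesis .
qed


subsection \<open>The preconditioned spectrum\<close>

lemma mat_form_diff_right:
  "mat_form A u (\<lambda>j. s * x j - t * y j) = s * mat_form A u x - t * mat_form A u y"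
  by (simp add: mat_form_def algebra_simps sum_subtractf sum_distrib_left)

lemma mat_form_mult_mat_vec:
  assumes "A \<in> carrier_mat N N" "w \<in> carrier_vec N"
  shows "mat_form A u (vec_index w) = (\<Sum>j<N. u j * (A *\<^sub>v w) $ j)"
  using assms by (simp add: mat_form_def scalar_prod_def atLeast0LessThan sum_distrib_left mult_ac)

text \<open>The spectral argument, free of any Toeplitz structure: \<open>A_rev\<close> expresses
  that \<open>anti_id N * A\<close> is symmetric, and \<open>P_rev\<close> that \<open>P\<close>
  commutes with \<open>anti_id N\<close>.\<close>

lemma spectrum_symmetrized_subset:
  fixes A P Pinv :: "real mat" and c :: real
  assumes A: "A \<in> carrier_mat N N" and P: "P \<in> carrier_mat N N" and Pinv: "Pinv \<in> carrier_mat N N"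
    and inv: "P * Pinv = 1\<^sub>m N"
    and P_sym: "\<And>x y. mat_form P x y = mat_form P y x"
    and P_rev: "\<And>x y. mat_form P (\<lambda>j. x (N - Suc j)) (\<lambda>j. y (N - Suc j)) = mat_form P x y"
    and P_pos: "\<And>x. \<exists>j<N. x j \<noteq> 0 \<Longrightarrow> 0 < mat_form P x x"
    and A_rev: "\<And>x y. mat_form A (\<lambda>j. x (N - Suc j)) y = mat_form A (\<lambda>j. y (N - Suc j)) x"
    and lower: "\<And>x. \<exists>j<N. x j \<noteq> 0 \<Longrightarrow> mat_form P x x / 2 < mat_form A x x"
    and upper: "\<And>x y. \<exists>j<N. x j \<noteq> 0 \<Longrightarrow>
      \<bar>mat_form A y x\<bar> < c / 2 * (mat_form P x x + mat_form P y y)"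
  shows "spectrum (map_mat complex_of_real (Pinv * anti_id N * A))
    \<subseteq> complex_of_real ` {s. 1 / 2 < \<bar>s\<bar> \<and> \<bar>s\<bar> < c}"
proof
  let ?M = "Pinv * anti_id N * A"
  have M: "?M \<in> carrier_mat N N"
    by (intro mult_carrier_mat[OF mult_carrier_mat[OF Pinv anti_id_carrier] A])
  let ?rev = "\<lambda>w j. w (N - Suc j)"
  \<comment> \<open>Multiplying by \<open>P\<close> cancels \<open>Pinv\<close>, and the
    anti-identity is moved to the left argument as a reversal.\<close>
  have PM: "mat_form P u (vec_index (?M *\<^sub>v w)) = mat_form A (?rev u) (vec_index w)"
    if w: "w \<in> carrier_vec N" for u w
  proof -
    have Aw: "A *\<^sub>v w \<in> carrier_vec N" using A w by simp
    have "P * ?M = P * (Pinv * (anti_id N * A))"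
      using A Pinv by (simp add: assoc_mult_mat[OF Pinv anti_id_carrier A])
    also have "\<dots> = (P * Pinv) * (anti_id N * A)"
      by (rule assoc_mult_mat[OF P Pinv mult_carrier_mat[OF anti_id_carrier A], symmetric])
    also have "\<dots> = anti_id N * A"
      unfolding inv by (rule left_mult_one_mat[OF mult_carrier_mat[OF anti_id_carrier A]])
    finally have PMeq: "P * ?M = anti_id N * A" .
    have "mat_form P u (vec_index (?M *\<^sub>v w)) = (\<Sum>j<N. u j * (P *\<^sub>v (?M *\<^sub>v w)) $ j)"
      using M w by (intro mat_form_mult_mat_vec[OF P]) simp
    also have "P *\<^sub>v (?M *\<^sub>v w) = (P * ?M) *\<^sub>v w"
      by (rule assoc_mult_mat_vec[OF P M w, symmetric])
    also have "\<dots> = anti_id N *\<^sub>v (A *\<^sub>v w)"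
      unfolding PMeq by (rule assoc_mult_mat_vec[OF anti_id_carrier A w])
    also have "(\<Sum>j<N. u j * (anti_id N *\<^sub>v (A *\<^sub>v w)) $ j) = vec N u \<bullet> (anti_id N *\<^sub>v (A *\<^sub>v w))"
      by (simp add: scalar_prod_def atLeast0LessThan anti_id_def)
    also have "\<dots> = (\<Sum>j<N. vec N u $ (N - Suc j) * (A *\<^sub>v w) $ j)"
      by (rule scalar_prod_anti_id) (simp_all add: Aw)
    also have "\<dots> = (\<Sum>j<N. ?rev u j * (A *\<^sub>v w) $ j)"
      by (intro sum.cong) auto
    also have "\<dots> = mat_form A (?rev u) (vec_index w)"
      by (rule mat_form_mult_mat_vec[OF A w, symmetric])
    finally show ?thesis .
  qed
  fix l assume "l \<in> spectrum (map_mat complex_of_real ?M)"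
  then obtain z where z: "z \<in> carrier_vec N" "z \<noteq> 0\<^sub>v N"
      "map_mat complex_of_real ?M *\<^sub>v z = l \<cdot>\<^sub>v z"
    using M by (auto simp: spectrum_def eigenvalue_def eigenvector_def)
  define x where "x = map_vec Re z"
  define y where "y = map_vec Im z"
  define s where "s = Re l"
  define t where "t = Im l"
  have x: "x \<in> carrier_vec N" and y: "y \<in> carrier_vec N"
    using z(1) by (auto simp: x_def y_def)
  have ev: "(\<Sum>k<N. complex_of_real (?M $$ (j, k)) * z $ k) = l * z $ j" if "j < N" for j
    using arg_cong[OF z(3), of "\<lambda>v. v $ j"] that z(1) M
    by (auto simp: scalar_prod_def atLeast0LessThan simp del: index_mult_mat)
  have Mx: "(?M *\<^sub>v x) $ j = s * x $ j - t * y $ j" if "j < N" for j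
    using arg_cong[OF ev[OF that], of Re] that z(1) M
    by (simp add: scalar_prod_def atLeast0LessThan x_def y_def s_def t_def del: index_mult_mat)
  have My: "(?M *\<^sub>v y) $ j = s * y $ j - (- t) * x $ j" if "j < N" for j
    using arg_cong[OF ev[OF that], of Im] that z(1) M
    by (simp add: scalar_prod_def atLeast0LessThan x_def y_def s_def t_def del: index_mult_mat)
  let ?X = "vec_index x" and ?Y = "vec_index y"
  have ex: "mat_form A (?rev u) ?X = s * mat_form P u ?X - t * mat_form P u ?Y" for u
    unfolding PM[OF x, symmetric] mat_form_diff_right[symmetric]
    using P Mx by (intro mat_form_cong) auto
  have ey: "mat_form A (?rev u) ?Y = s * mat_form P u ?Y - (- t) * mat_form P u ?X" for u
    unfolding PM[OF y, symmetric] mat_form_diff_right[symmetric]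
    using P My by (intro mat_form_cong) auto
  have nz: "(\<exists>j<N. x $ j \<noteq> 0) \<or> (\<exists>j<N. y $ j \<noteq> 0)"
  proof (rule ccontr)
    assume "\<not> ?thesis"
    then have "z = 0\<^sub>v N"
      using z(1) by (intro eq_vecI) (auto simp: x_def y_def complex_eq_iff)
    with z(2) show False by simp
  qed
  have P_nonneg: "0 \<le> mat_form P w w" for w
  proof (cases "\<exists>j<N. w j \<noteq> 0")
    case False
    then show ?thesis using P by (simp add: mat_form_def)
  qed (use P_pos in force)
  \<comment> \<open>The real part of the eigenvalue equation is tested with \<open>y\<close> and the
    imaginary part with \<open>x\<close>. By symmetry the terms with \<open>s\<close> agree and
    cancel.\<close>
  have "t * (mat_form P ?X ?X + mat_form P ?Y ?Y) = 0"
    using ex[of ?Y] ey[of ?X] A_rev[of ?X ?Y] P_sym[of ?X ?Y] by (simp add: algebra_simps)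
  moreover have "0 < mat_form P ?X ?X + mat_form P ?Y ?Y"
    using nz P_pos P_nonneg by (auto intro: add_pos_nonneg add_nonneg_pos)
  ultimately have t: "t = 0" by simp
  obtain W where W: "\<exists>j<N. W j \<noteq> 0"
    and eW: "\<And>u. mat_form A (?rev u) W = s * mat_form P u W"
    using nz ex ey t by auto
  have pos: "0 < mat_form P W W" by (rule P_pos[OF W])
  have rev: "mat_form P (?rev W) (?rev W) = mat_form P W W" by (rule P_rev)
  \<comment> \<open>For \<open>y\<close> the reversal of \<open>W\<close>, both forms on the right
    of \<open>upper\<close> equal \<open>mat_form P W W\<close>.\<close>
  have "\<bar>s\<bar> * mat_form P W W < c * mat_form P W W"
    using upper[OF W, of "?rev W"] unfolding rev eW abs_mult using pos by simp
  then have "\<bar>s\<bar> < c" using pos by simp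
  moreover have "1 / 2 < \<bar>s\<bar>"
  proof -
    \<comment> \<open>Reversing twice is the identity below \<open>N\<close>, so the eigenvalue
      equation applies to the quadratic form of \<open>A\<close>.\<close>
    have "mat_form A W W = mat_form A (?rev (?rev W)) W"
      using A by (intro mat_form_cong) auto
    then have "mat_form P W W / 2 < s * mat_form P (?rev W) W"
      using lower[OF W] eW[of "?rev W"] by simp
    also have "\<dots> \<le> \<bar>s\<bar> * \<bar>mat_form P (?rev W) W\<bar>"
      by (metis abs_ge_self abs_mult)
    also have "\<dots> \<le> \<bar>s\<bar> * mat_form P W W"
    proof (rule mult_left_mono)
      show "\<bar>mat_form P (?rev W) W\<bar> \<le> mat_form P W W"
        using mat_form_psd_polarization[OF P_nonneg P, of "?rev W" W] rev P_sym[of W "?rev W"] by simp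
    qed simp
    finally show ?thesis using pos by simp
  qed
  moreover have "l = complex_of_real s"
    using t by (simp add: complex_eq_iff s_def t_def)
  ultimately show "l \<in> complex_of_real ` {s. 1 / 2 < \<bar>s\<bar> \<and> \<bar>s\<bar> < c}"
    by auto
qed

section \<open>Application to the matrices of the scheme\<close>

lemma L_mat_carrier: "L_mat a m \<in> carrier_mat m m"
  by (simp add: L_mat_def)

lemma tau_sym_L_mat_carrier: "tau_mat (sym_part (L_mat a m)) \<in> carrier_mat m m"
  by (rule carrier_matI) simp_all

lemma at_level_L_mat_form_bounds:
  fixes n :: "nat \<Rightarrow> nat" and d i m :: nat
  assumes a: "1 < a" "a < 2"
  defines "B \<equiv> mat_form (at_level d n i (L_mat a m))"
    and "C \<equiv> mat_form (at_level d n i (tau_mat (sym_part (L_mat a m))))"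
  shows "C x x / 2 \<le> B x x" "B x x \<le> 3 / 2 * C x x"
    and "\<bar>B x y - B y x\<bar> \<le> \<bar>tan (a / 2 * pi)\<bar> * (B x x + B y y)"
proof -
  note c = L_mat_carrier[of a m] tau_sym_L_mat_carrier[of a m]
  show "C x x / 2 \<le> B x x" "B x x \<le> 3 / 2 * C x x"
    unfolding B_def C_def mat_form_at_level[OF c(1)] mat_form_at_level[OF c(2)]
      sum_divide_distrib sum_distrib_left
    by (intro sum_mono tau_L_mat_form_bounds[OF a])+
  show "\<bar>B x y - B y x\<bar> \<le> \<bar>tan (a / 2 * pi)\<bar> * (B x x + B y y)"
    unfolding B_def mat_form_at_level[OF c(1)] sum_subtractf[symmetric] sum.distrib[symmetric]
      sum_distrib_left
    by (intro order.trans[OF sum_abs] sum_mono L_mat_form_skew_le[OF a])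
qed

theorem theorem4p2:
  fixes d M :: nat
    and T \<tau> \<nu> :: real
    and a b \<alpha> dp dm h vp vm :: "nat \<Rightarrow> real"
    and n :: "nat \<Rightarrow> nat"
    and A P Y :: "real mat"
  assumes "d \<ge> 1"
    and "\<And>i. i \<in> {1..d} \<Longrightarrow> a i < b i"
    and "\<And>i. i \<in> {1..d} \<Longrightarrow> 1 < \<alpha> i \<and> \<alpha> i < 2"
    and "\<And>i. i \<in> {1..d} \<Longrightarrow> dp i \<ge> 0 \<and> dm i \<ge> 0"
    and "\<And>i. i \<in> {1..d} \<Longrightarrow> n i \<ge> 1"
    and "T > 0" and "M \<ge> 1"
    and "\<tau> = T / real M" and "\<nu> = 1 / \<tau>"
    and "\<And>i. i \<in> {1..d} \<Longrightarrow> h i = (b i - a i) / (real (n i) + 1)"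
    and "\<And>i. i \<in> {1..d} \<Longrightarrow> vp i = dp i / (2 * h i powr \<alpha> i)"
    and "\<And>i. i \<in> {1..d} \<Longrightarrow> vm i = dm i / (2 * h i powr \<alpha> i)"
    and "A = A_mat d n \<alpha> \<nu> vp vm"
    and "P = P_mat d n \<alpha> \<nu> vp vm"
    and "Y = multi_anti_id d n"
  shows "\<exists>Pinv. inverts_mat P Pinv \<and> inverts_mat Pinv P \<and>
    (\<exists>\<epsilon>. \<epsilon> < Max ((\<lambda>i. \<bar>dp i - dm i\<bar> / (dp i + dm i) * \<bar>tan (\<alpha> i / 2 * pi)\<bar>) ` {1..d}) \<and>
      spectrum (map_mat complex_of_real (Pinv * Y * A)) \<subseteq>
        complex_of_real ` ({- (3/2) * (1 + \<epsilon>) <..< - (1/2)} \<union> {1/2 <..< 3/2 * (1 + \<epsilon>)}))"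
proof -
  define N where "N = (\<Prod>i = 1..d. n i)"
  define E where "E = Max ((\<lambda>i. \<bar>dp i - dm i\<bar> / (dp i + dm i) * \<bar>tan (\<alpha> i / 2 * pi)\<bar>) ` {1..d})"
  define Li where "Li i = at_level d n i (L_mat (\<alpha> i) (n i))" for i
  define Ti where "Ti i = at_level d n i (tau_mat (sym_part (L_mat (\<alpha> i) (n i))))" for i
  define B where "B i = mat_form (Li i)" for i
  define C where "C i = mat_form (Ti i)" for i
  let ?rev = "\<lambda>w j. w (N - Suc j)"
  have \<nu>: "0 < \<nu>"
    using assms(6-9) by simp
  have alpha: "1 < \<alpha> i" "\<alpha> i < 2" if "i \<in> {1..d}" for i
    using assms(3)[OF that] by auto
  have Eupper: "\<bar>dp i - dm i\<bar> / (dp i + dm i) * \<bar>tan (\<alpha> i / 2 * pi)\<bar> \<le> E" if "i \<in> {1..d}" for i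
    unfolding E_def using that by (intro Max_ge) auto
  have "0 \<le> \<bar>dp 1 - dm 1\<bar> / (dp 1 + dm 1) * \<bar>tan (\<alpha> 1 / 2 * pi)\<bar>"
    using assms(1) assms(4)[of 1] by simp
  also have "\<dots> \<le> E" using assms(1) by (intro Eupper) auto
  finally have E0: "0 \<le> E" .
  have v: "0 \<le> vp i" "0 \<le> vm i" "\<bar>vp i - vm i\<bar> * \<bar>tan (\<alpha> i / 2 * pi)\<bar> \<le> E * (vp i + vm i)"
    if i: "i \<in> {1..d}" for i
  proof -
    define k where "k = 1 / (2 * h i powr \<alpha> i)"
    have k: "0 \<le> k" by (simp add: k_def)
    have vk: "vp i = dp i * k" "vm i = dm i * k"
      using assms(11,12)[OF i] by (simp_all add: k_def)
    then show "0 \<le> vp i" "0 \<le> vm i"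
      using assms(4)[OF i] k by auto
    have "\<bar>dp i - dm i\<bar> * \<bar>tan (\<alpha> i / 2 * pi)\<bar> \<le> E * (dp i + dm i)"
    \<comment> \<open>If the denominator vanishes, so do both nonnegative constants, and both sides
      are 0.\<close>
    proof (cases "dp i + dm i = 0")
      case True
      then have "dp i = 0" "dm i = 0" using assms(4)[OF i] by auto
      then show ?thesis by simp
    next
      case False
      then have "0 < dp i + dm i" using assms(4)[OF i] by auto
      then show ?thesis using Eupper[OF i] by (simp add: field_simps)
    qed
    from mult_right_mono[OF this k]
    show "\<bar>vp i - vm i\<bar> * \<bar>tan (\<alpha> i / 2 * pi)\<bar> \<le> E * (vp i + vm i)"
      unfolding vk left_diff_distrib[symmetric] abs_mult using k by (simp add: algebra_simps)
  qed
  have carr: "Li i \<in> carrier_mat N N" "Ti i \<in> carrier_mat N N" if "i \<in> {1..d}" for i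
    unfolding Li_def Ti_def N_def 
    by (rule at_level_carrier[OF L_mat_carrier that] at_level_carrier[OF tau_sym_L_mat_carrier that])+
  have A_eq: "A = \<nu> \<cdot>\<^sub>m 1\<^sub>m N + level_sum N d (\<lambda>i. vp i \<cdot>\<^sub>m Li i + vm i \<cdot>\<^sub>m transpose_mat (Li i))"
    unfolding assms(13) A_mat_def Let_def N_def Li_def ..
  have P_eq: "P = \<nu> \<cdot>\<^sub>m 1\<^sub>m N + level_sum N d (\<lambda>i. (vp i + vm i) \<cdot>\<^sub>m Ti i)"
    unfolding assms(14) P_mat_def Let_def N_def Ti_def ..
  have Y_eq: "Y = anti_id N"
    unfolding assms(15) N_def by (rule multi_anti_id_eq)
  have lsA: "level_sum N d (\<lambda>i. vp i \<cdot>\<^sub>m Li i + vm i \<cdot>\<^sub>m transpose_mat (Li i)) \<in> carrier_mat N N"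
    using carr by (intro mat_form_level_sum) auto
  have lsP: "level_sum N d (\<lambda>i. (vp i + vm i) \<cdot>\<^sub>m Ti i) \<in> carrier_mat N N"
    using carr by (intro mat_form_level_sum) auto
  have A: "A \<in> carrier_mat N N" and P: "P \<in> carrier_mat N N"
    unfolding A_eq P_eq using lsA lsP by auto
  have A_form: "mat_form A x y = \<nu> * (\<Sum>j<N. x j * y j) + (\<Sum>i = 1..d. vp i * B i x y + vm i * B i y x)" for x y
  proof -
    have "mat_form (level_sum N d (\<lambda>i. vp i \<cdot>\<^sub>m Li i + vm i \<cdot>\<^sub>m transpose_mat (Li i))) x y
      = (\<Sum>i = 1..d. mat_form (vp i \<cdot>\<^sub>m Li i + vm i \<cdot>\<^sub>m transpose_mat (Li i)) x y)"
      using carr by (intro mat_form_level_sum) auto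
    also have "\<dots> = (\<Sum>i = 1..d. vp i * B i x y + vm i * B i y x)"
      using carr by (intro sum.cong refl)
        (simp add: mat_form_add_mat[of _ N N] mat_form_smult_mat mat_form_transpose B_def)
    finally show ?thesis
      unfolding A_eq using lsA by (simp add: mat_form_add_mat[of _ N N] mat_form_smult_mat mat_form_one)
  qed
  have P_form: "mat_form P x y = \<nu> * (\<Sum>j<N. x j * y j) + (\<Sum>i = 1..d. (vp i + vm i) * C i x y)" for x y
  proof -
    have "mat_form (level_sum N d (\<lambda>i. (vp i + vm i) \<cdot>\<^sub>m Ti i)) x y
      = (\<Sum>i = 1..d. mat_form ((vp i + vm i) \<cdot>\<^sub>m Ti i) x y)"
      using carr by (intro mat_form_level_sum) auto
    then show ?thesis
      unfolding P_eq using lsP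
      by (simp add: mat_form_add_mat[of _ N N] mat_form_smult_mat mat_form_one C_def)
  qed
  have rev_inner: "(\<Sum>j<N. x (N - Suc j) * y (N - Suc j)) = (\<Sum>j<N. x j * y j)" for x y :: "nat \<Rightarrow> real"
    by (rule sum.nat_diff_reindex)
  have B_rev: "B i (?rev x) y = B i (?rev y) x" if i: "i \<in> {1..d}" for i x y
  proof -
    have "B i (?rev x) y = mat_form (transpose_mat (Li i)) y (?rev x)"
      by (simp add: B_def mat_form_transpose)
    also have "transpose_mat (Li i) = flip_mat (Li i)"
      unfolding Li_def by (simp add: flip_mat_at_level transpose_at_level flip_L_mat)
    also have "mat_form (flip_mat (Li i)) y (?rev x) = B i (?rev y) (?rev (?rev x))"
      unfolding B_def by (rule mat_form_flip_mat[OF carr(1)[OF i]])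
    also have "\<dots> = B i (?rev y) x"
      unfolding B_def using carr(1)[OF i] by (intro mat_form_cong) auto
    finally show ?thesis .
  qed
  have B_rev': "B i x (?rev y) = B i y (?rev x)" if i: "i \<in> {1..d}" for i x y
  proof -
    have "B i x (?rev y) = B i (?rev (?rev x)) (?rev y)"
      unfolding B_def using carr(1)[OF i] by (intro mat_form_cong) auto
    also have "\<dots> = B i (?rev (?rev y)) (?rev x)" by (rule B_rev[OF i])
    also have "\<dots> = B i y (?rev x)"
      unfolding B_def using carr(1)[OF i] by (intro mat_form_cong) auto
    finally show ?thesis .
  qed
  have C_sym: "C i x y = C i y x" for i x y
    by (subst mat_form_transpose[symmetric, of "Ti i" x y, folded C_def])
       (simp add: C_def Ti_def transpose_at_level transpose_tau_L_mat)
  have C_rev: "C i (?rev x) (?rev y) = C i x y" if i: "i \<in> {1..d}" for i x y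
    using mat_form_flip_mat[OF carr(2)[OF i], of x y]
    by (simp add: C_def Ti_def flip_mat_at_level flip_tau_L_mat)
  have BC: "C i x x / 2 \<le> B i x x" "B i x x \<le> 3 / 2 * C i x x"
    "\<bar>B i x y - B i y x\<bar> \<le> \<bar>tan (\<alpha> i / 2 * pi)\<bar> * (B i x x + B i y y)" if "i \<in> {1..d}" for i x y
    unfolding B_def C_def Li_def Ti_def
    by (rule at_level_L_mat_form_bounds[OF alpha[OF that]])+
  have C0: "0 \<le> C i x x" if "i \<in> {1..d}" for i x
    using BC(1,2)[OF that, of x] by linarith
  have B0: "0 \<le> B i x x" if "i \<in> {1..d}" for i x
    using BC(1)[OF that, of x] C0[OF that, of x] by linarith
  have inner_pos: "0 < (\<Sum>j<N. x j * x j)" if nz: "\<exists>j<N. x j \<noteq> 0" for x :: "nat \<Rightarrow> real"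
  proof -
    obtain j where "j < N" "x j \<noteq> 0" using nz by blast
    then show ?thesis by (intro sum_pos2[of _ j]) (auto simp: zero_less_mult_iff)
  qed
  have P_sym: "mat_form P x y = mat_form P y x" for x y
    unfolding P_form by (simp add: C_sym mult.commute)
  have P_rev: "mat_form P (?rev x) (?rev y) = mat_form P x y" for x y
    unfolding P_form rev_inner by (simp add: C_rev)
  have P_pos: "0 < mat_form P x x" if "\<exists>j<N. x j \<noteq> 0" for x
    unfolding P_form using \<nu> inner_pos[OF that] v C0
    by (intro add_pos_nonneg mult_pos_pos sum_nonneg mult_nonneg_nonneg add_nonneg_nonneg) auto
  have A_rev: "mat_form A (?rev x) y = mat_form A (?rev y) x" for x y
  proof -
    have "(\<Sum>j<N. x (N - Suc j) * y j) = (\<Sum>j<N. x (N - Suc j) * y (N - Suc (N - Suc j)))"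
      by (intro sum.cong) auto
    also have "\<dots> = (\<Sum>j<N. x j * y (N - Suc j))"
      by (rule sum.nat_diff_reindex)
    finally show ?thesis
      unfolding A_form by (simp add: B_rev[of _ x] B_rev'[of _ y x] mult.commute)
  qed
  have lower: "mat_form P x x / 2 < mat_form A x x" if "\<exists>j<N. x j \<noteq> 0" for x
  proof -
    have "(\<Sum>i = 1..d. (vp i + vm i) * C i x x) / 2 \<le> (\<Sum>i = 1..d. vp i * B i x x + vm i * B i x x)"
      unfolding sum_divide_distrib
    proof (rule sum_mono)
      fix i assume i: "i \<in> {1..d}"
      show "(vp i + vm i) * C i x x / 2 \<le> vp i * B i x x + vm i * B i x x"
        using mult_left_mono[OF BC(1)[OF i, of x], of "vp i + vm i"] v[OF i] by (simp add: algebra_simps)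
    qed
    \<comment> \<open>Strictness: \<open>A\<close> contains this term in full, half of
      \<open>P\<close> only half of it.\<close>
    moreover have "0 < \<nu> * (\<Sum>j<N. x j * x j)" using \<nu> inner_pos[OF that] by simp
    ultimately show ?thesis
      unfolding A_form P_form by (simp add: add_divide_distrib)
  qed
  have upper: "\<bar>mat_form A y x\<bar> < 3 / 2 * (1 + E) / 2 * (mat_form P x x + mat_form P y y)"
    if "\<exists>j<N. x j \<noteq> 0" for x y
  proof -
    define Q where "Q = (\<Sum>j<N. x j * x j) + (\<Sum>j<N. y j * y j)"
    have Q: "0 < Q"
      unfolding Q_def using inner_pos[OF that] by (intro add_pos_nonneg sum_nonneg) auto
    have yx: "\<bar>\<Sum>j<N. y j * x j\<bar> \<le> Q / 2"
      using mat_form_psd_polarization[of "1\<^sub>m N" N y x]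
      by (simp add: mat_form_one Q_def sum_nonneg mult.commute)
    have level: "\<bar>vp i * B i y x + vm i * B i x y\<bar>
        \<le> 3 / 2 * (1 + E) / 2 * ((vp i + vm i) * (C i x x + C i y y))" if i: "i \<in> {1..d}" for i
    proof -
      define S where "S = B i x x + B i y y"
      have S: "0 \<le> S" unfolding S_def using B0[OF i] by simp
      have s: "\<bar>B i y x + B i x y\<bar> \<le> S"
        using mat_form_psd_polarization[OF B0[OF i, unfolded B_def] carr(1)[OF i], of y x]
        by (simp add: S_def B_def)
      \<comment> \<open>Symmetric and skew parts are separated. Polarization bounds the first by
        \<open>S\<close>; the sector bounds the second, and its weight
        \<open>\<bar>vp i - vm i\<bar>\<close> times the tangent is absorbed by
        \<open>E\<close>.\<close>
      have "vp i * B i y x + vm i * B i x y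
          = (vp i + vm i) / 2 * (B i y x + B i x y) + (vp i - vm i) / 2 * (B i y x - B i x y)"
        by (simp add: field_simps)
      also have "\<bar>\<dots>\<bar> \<le> (vp i + vm i) / 2 * \<bar>B i y x + B i x y\<bar> + \<bar>vp i - vm i\<bar> / 2 * \<bar>B i y x - B i x y\<bar>"
        using abs_triangle_ineq[of "(vp i + vm i) / 2 * (B i y x + B i x y)" "(vp i - vm i) / 2 * (B i y x - B i x y)"]
          v(1,2)[OF i] by (simp add: abs_mult)
      also have "\<dots> \<le> (vp i + vm i) / 2 * S + \<bar>vp i - vm i\<bar> / 2 * (\<bar>tan (\<alpha> i / 2 * pi)\<bar> * S)"
        using s BC(3)[OF i, of y x] v(1,2)[OF i]
        by (intro add_mono mult_left_mono) (auto simp: S_def add.commute)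
      also have "\<dots> \<le> (vp i + vm i) / 2 * S + E * (vp i + vm i) / 2 * S"
        using mult_right_mono[OF v(3)[OF i] S] by (simp add: mult.assoc)
      also have "(vp i + vm i) / 2 * S + E * (vp i + vm i) / 2 * S = (1 + E) / 2 * (vp i + vm i) * S"
        by (simp add: field_simps)
      also have "\<dots> \<le> (1 + E) / 2 * (vp i + vm i) * (3 / 2 * (C i x x + C i y y))"
        using BC(2)[OF i, of x] BC(2)[OF i, of y] E0 v(1,2)[OF i]
        by (intro mult_left_mono) (auto simp: S_def)
      also have "u / 2 * w * (3 / 2 * z) = 3 / 2 * u / 2 * (w * z)" for u w z :: real
        by simp
      finally show ?thesis .
    qed
    have "\<bar>mat_form A y x\<bar> \<le> \<nu> * \<bar>\<Sum>j<N. y j * x j\<bar> + \<bar>\<Sum>i = 1..d. vp i * B i y x + vm i * B i x y\<bar>"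
      unfolding A_form using \<nu> by (intro order.trans[OF abs_triangle_ineq]) (simp add: abs_mult)
    also have "\<dots> \<le> \<nu> * (Q / 2) + (\<Sum>i = 1..d. 3 / 2 * (1 + E) / 2 * ((vp i + vm i) * (C i x x + C i y y)))"
    proof (rule add_mono)
      show "\<nu> * \<bar>\<Sum>j<N. y j * x j\<bar> \<le> \<nu> * (Q / 2)"
        using yx \<nu> by (intro mult_left_mono) auto
      show "\<bar>\<Sum>i = 1..d. vp i * B i y x + vm i * B i x y\<bar>
        \<le> (\<Sum>i = 1..d. 3 / 2 * (1 + E) / 2 * ((vp i + vm i) * (C i x x + C i y y)))"
        by (rule order.trans[OF sum_abs sum_mono[OF level]])
    qed
    \<comment> \<open>The factor of \<open>\<nu> * Q\<close> rises from 1/2 to at least 3/4.\<close>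
    also have "\<dots> < 3 / 2 * (1 + E) / 2 * (\<nu> * Q)
        + (\<Sum>i = 1..d. 3 / 2 * (1 + E) / 2 * ((vp i + vm i) * (C i x x + C i y y)))"
    proof -
      have "0 < \<nu> * Q" "0 \<le> E * (\<nu> * Q)" using \<nu> Q E0 by auto
      then show ?thesis by (simp add: field_simps)
    qed
    also have "\<dots> = 3 / 2 * (1 + E) / 2 * (mat_form P x x + mat_form P y y)"
    proof -
      have "mat_form P x x + mat_form P y y = \<nu> * Q + (\<Sum>i = 1..d. (vp i + vm i) * (C i x x + C i y y))"
        by (simp add: P_form Q_def distrib_left sum.distrib)
      then show ?thesis by (simp only: distrib_left sum_distrib_left)
    qed
    finally show ?thesis .
  qed
  have "det P \<noteq> 0"
  proof
    assume "det P = 0"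
    then obtain w where w: "w \<in> carrier_vec N" "w \<noteq> 0\<^sub>v N" "P *\<^sub>v w = 0\<^sub>v N"
      using det_0_iff_vec_prod_zero_field[OF P] by blast
    have "\<exists>j<N. w $ j \<noteq> 0"
      using w(1,2) by (metis carrier_vecD eq_vecI index_zero_vec)
    then have "0 < mat_form P (vec_index w) (vec_index w)" by (rule P_pos)
    then show False
      using mat_form_mult_mat_vec[OF P w(1)] w(3) by simp
  qed
  from det_non_zero_imp_unit[OF P this, of "()"]
  obtain Pinv where Pinv: "Pinv \<in> carrier_mat N N" "P * Pinv = 1\<^sub>m N" "Pinv * P = 1\<^sub>m N"
    by (auto simp: Units_def ring_mat_def)
  let ?S = "spectrum (map_mat complex_of_real (Pinv * Y * A))"
  have S: "?S \<subseteq> complex_of_real ` {s. 1 / 2 < \<bar>s\<bar> \<and> \<bar>s\<bar> < 3 / 2 * (1 + E)}"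
    unfolding Y_eq
    by (rule spectrum_symmetrized_subset[OF A P Pinv(1,2) P_sym P_rev P_pos A_rev lower upper])
  have fin: "finite ?S"
    unfolding Y_eq
    by (rule card_finite_spectrum[OF map_carrier_mat[THEN iffD2, OF
          mult_carrier_mat[OF mult_carrier_mat[OF Pinv(1) anti_id_carrier] A]]])
  \<comment> \<open>The spectral radius. Inserting \<open>0\<close> makes the set nonempty without
    an appeal to the existence of eigenvalues.\<close>
  define r where "r = Max (insert 0 (norm ` ?S))"
  have "r < 3 / 2 * (1 + E)"
    unfolding r_def using fin S E0 by (subst Max_less_iff) auto
  then obtain c where c: "r < c" "c < 3 / 2 * (1 + E)"
    using dense by blast
  \<comment> \<open>Solves \<open>3 / 2 * (1 + \<epsilon>) = c\<close> for a \<open>c\<close>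
    strictly between \<open>r\<close> and the bound. It is negative when
    \<open>E = 0\<close>.\<close>
  define \<epsilon> where "\<epsilon> = 2 / 3 * c - 1"
  have \<epsilon>: "3 / 2 * (1 + \<epsilon>) = c" "- (3 / 2) * (1 + \<epsilon>) = - c"
    by (simp_all add: \<epsilon>_def)
  have "\<epsilon> < E" using c(2) by (simp add: \<epsilon>_def)
  moreover have "?S \<subseteq> complex_of_real ` ({- (3/2) * (1 + \<epsilon>) <..< - (1/2)} \<union> {1/2 <..< 3/2 * (1 + \<epsilon>)})"
  proof
    fix l assume l: "l \<in> ?S"
    then obtain s where s: "l = complex_of_real s" "1 / 2 < \<bar>s\<bar>" using S by blast
    have "norm l \<le> r" unfolding r_def using fin l by (intro Max_ge) auto
    then have "\<bar>s\<bar> < c" using c(1) unfolding s(1) by simp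
    then have "s \<in> {- (3/2) * (1 + \<epsilon>) <..< - (1/2)} \<union> {1/2 <..< 3/2 * (1 + \<epsilon>)}"
      using s(2) unfolding \<epsilon> by (auto simp: abs_if split: if_splits)
    then show "l \<in> complex_of_real ` ({- (3/2) * (1 + \<epsilon>) <..< - (1/2)} \<union> {1/2 <..< 3/2 * (1 + \<epsilon>)})"
      unfolding s(1) by (rule imageI)
  qed
  moreover have "inverts_mat P Pinv" "inverts_mat Pinv P"
    using P Pinv by (auto simp: inverts_mat_def)
  ultimately show ?thesis
    unfolding E_def by blast
qed

end
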